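(* Let $R$ be an invertible $d\times d$ matrix with real entries, let $M=R\mathbb{Z}^d$ be the lattice generated by the columns of $R$, and let $E\subset\mathbb{R}^d$ be a finite set with $|E|$ elements. Let $I^d=[0,1)^d$ and $$\mathbf{Z}_{I^d}=\{z\in\mathbb{R}^d\setminus\{0\}:\exists j\in\{1,\dots,d\}\text{ with }z_j\in\mathbb{Z}\setminus\{0\}\}.$$ If $M\cap(E-E)=\{0\}$, then the following are equivalent: (1) $(I^d,M+E)$ is a spectral pair; (2) $I^d$ is an $(M+E)$-tile; (3) $|E|=|\det R|$ and $M+(E-E)\subset\mathbf{Z}_{I^d}\cup\{0\}$.
   Context: For a measurable set $\Omega\subset\mathbb{R}^d$ of finite positive Lebesgue measure and a set $\Lambda\subset\mathbb{R}^d$, $(\Omega,\Lambda)$ is called a spectral pair if the exponentials $e_\lambda(x)=e^{i2\pi\lambda\cdot x}$, $\lambda\in\Lambda$, form an orthogonal basis of $\mathcal{L}^2(\Omega)$. For $T\subset\mathbb{R}^d$, $\Omega$ is a $T$-tile if the translates $\Omega+t$, $t\in T$, cover $\mathbb{R}^d$ up to a null set and distinct translates intersect in Lebesgue-null sets. $A+B=\{a+b:a\in A,b\in B\}$, $A-B=\{a-b:a\in A,b\in B\}$. *)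

theory Defs
  imports "HOL-Analysis.Analysis"
begin

definition expo :: "real^'n \<Rightarrow> real^'n \<Rightarrow> complex" where
  "expo l x = exp (\<i> * complex_of_real (2 * pi * (l \<bullet> x)))"

definition in_L2 :: "(real^'n) set \<Rightarrow> (real^'n \<Rightarrow> complex) \<Rightarrow> bool" where
  "in_L2 \<Omega> f \<longleftrightarrow> set_borel_measurable lebesgue \<Omega> f \<and>
     set_integrable lebesgue \<Omega> (\<lambda>x. (cmod (f x))\<^sup>2)"

definition L2_inner :: "(real^'n) set \<Rightarrow> (real^'n \<Rightarrow> complex) \<Rightarrow> (real^'n \<Rightarrow> complex) \<Rightarrow> complex" where
  "L2_inner \<Omega> f g = (LINT x:\<Omega>|lebesgue. f x * cnj (g x))"

text \<open>(Omega, Lambda) is a spectral pair: Omega measurable of finite positive measure, and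
  the exponentials e_lambda, lambda in Lambda, form an orthogonal basis of L^2(Omega), i.e.
  they are pairwise orthogonal and complete (only the zero element of L^2(Omega) is
  orthogonal to all of them).\<close>
definition spectral_pair :: "(real^'n) set \<Rightarrow> (real^'n) set \<Rightarrow> bool" where
  "spectral_pair \<Omega> \<Lambda> \<longleftrightarrow>
     \<Omega> \<in> sets lebesgue \<and> 0 < emeasure lebesgue \<Omega> \<and> emeasure lebesgue \<Omega> < \<infinity> \<and>
     (\<forall>l\<in>\<Lambda>. \<forall>m\<in>\<Lambda>. l \<noteq> m \<longrightarrow> L2_inner \<Omega> (expo l) (expo m) = 0) \<and>
     (\<forall>f. in_L2 \<Omega> f \<longrightarrow> (\<forall>l\<in>\<Lambda>. L2_inner \<Omega> f (expo l) = 0) \<longrightarrow>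
          (AE x in lebesgue. x \<in> \<Omega> \<longrightarrow> f x = 0))"

definition is_tile :: "(real^'n) set \<Rightarrow> (real^'n) set \<Rightarrow> bool" where
  "is_tile \<Omega> T \<longleftrightarrow>
     (UNIV - (\<Union>t\<in>T. (\<lambda>x. x + t) ` \<Omega>)) \<in> null_sets lebesgue \<and>
     (\<forall>t\<in>T. \<forall>t'\<in>T. t \<noteq> t' \<longrightarrow> ((\<lambda>x. x + t) ` \<Omega> \<inter> (\<lambda>x. x + t') ` \<Omega>) \<in> null_sets lebesgue)"

definition sumset :: "'a::plus set \<Rightarrow> 'a set \<Rightarrow> 'a set" where
  "sumset A B = {a + b | a b. a \<in> A \<and> b \<in> B}"

definition diffset :: "'a::minus set \<Rightarrow> 'a set \<Rightarrow> 'a set" where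
  "diffset A B = {a - b | a b. a \<in> A \<and> b \<in> B}"

definition lattice :: "real^'n^'n \<Rightarrow> (real^'n) set" where
  "lattice R = {R *v k | k. \<forall>i. k $ i \<in> \<int>}"

definition unit_cube :: "(real^'n) set" where
  "unit_cube = {x. \<forall>i. 0 \<le> x $ i \<and> x $ i < 1}"

definition Z_cube :: "(real^'n) set" where
  "Z_cube = {z. z \<noteq> 0 \<and> (\<exists>j. z $ j \<in> \<int> \<and> z $ j \<noteq> 0)}"

end

theory Submission
  imports Defs "HOL-Probability.Sinc_Integral"
begin

text \<open>
  Let \<open>\<Lambda> = M + E\<close>, let \<open>F\<close> be the Fourier transform of the indicator of the unit cube and \<open>D\<close> a
  fundamental domain of \<open>M\<close>, so that \<open>D\<close> has volume \<open>\<bar>det R\<bar>\<close>. For \<open>g \<ge> 0\<close> with integral 1 the sum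
  \<open>S(x) = \<Sum>\<lambda>\<in>\<Lambda>. g (x - \<lambda>)\<close> is \<open>M\<close>-periodic with integral \<open>card E\<close> over \<open>D\<close>; hence if \<open>S \<le> 1\<close>, then
  \<open>card E \<le> \<bar>det R\<bar>\<close>, with equality only if \<open>S = 1\<close> almost everywhere.

  The exponentials are orthogonal iff \<open>\<Lambda> - \<Lambda>\<close> lies in \<open>Z_cube \<union> {0}\<close>, and then the translated cubes are
  disjoint. Taking \<open>g\<close> to be the indicator of the cube, condition (3) gives a tiling; conversely, a tiling
  satisfies the difference condition by Keller's theorem. Taking \<open>g = \<bar>F\<bar>\<^sup>2\<close>, Bessel's inequality says \<open>S \<le> 1\<close>,
  and \<open>S = 1\<close> almost everywhere puts almost every exponential, hence every one, into the closed span of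
  those with frequencies in \<open>\<Lambda>\<close>. Finally, if \<open>card E < \<bar>det R\<bar>\<close>, completeness fails because of a finite
  combination of bumps placed on one coset of the dual lattice.
\<close>

section \<open>Cube tilings and Keller's theorem\<close>


lemma mem_translate_unit_cube:
  "x \<in> (\<lambda>y. y + t) ` unit_cube \<longleftrightarrow> (\<forall>i. t $ i \<le> x $ i \<and> x $ i < t $ i + 1)"
proof -
  have "x \<in> (\<lambda>y. y + t) ` unit_cube \<longleftrightarrow> x - t \<in> unit_cube"
    by (force simp: image_iff intro: bexI[where x="x - t"])
  also have "\<dots> \<longleftrightarrow> (\<forall>i. t $ i \<le> x $ i \<and> x $ i < t $ i + 1)"
    by (auto simp: unit_cube_def) (smt (verit))+
  finally show ?thesis .
qed

text \<open>The translations form an indexed family instead of a set, so that a cube keeps its name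
  while it is moved. Covering is required at every point, with no exceptional null set, so that a
  tiling can be restricted to single lines.\<close>

definition exact_tiling :: "('j \<Rightarrow> real^'n) \<Rightarrow> 'j set \<Rightarrow> bool" where
  "exact_tiling \<phi> J \<longleftrightarrow> (\<forall>x. \<exists>!j. j \<in> J \<and> (\<forall>i. \<phi> j $ i \<le> x $ i \<and> x $ i < \<phi> j $ i + 1))"

text \<open>The right end of a half-open interval must be the left end of another one. So every left
  end \<open>a q\<close> is followed by left ends \<open>a q + n\<close>, and the last of these that
  does not exceed \<open>a p\<close> can only be \<open>a p\<close> itself.\<close>

lemma unit_interval_tiling_congruent:
  fixes a :: "'j \<Rightarrow> real"
  assumes tiling: "\<And>x. \<exists>!j. j \<in> J \<and> a j \<le> x \<and> x < a j + 1"
    and "j \<in> J" "j' \<in> J"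
  shows "a j - a j' \<in> \<int>"
proof -
  have uniq: "p = q" if "p \<in> J" "q \<in> J" "a p \<le> x" "x < a p + 1" "a q \<le> x" "x < a q + 1" for p q x
    using tiling[of x] that by blast
  have up: "\<exists>q\<in>J. a q = a p + 1" if p: "p \<in> J" for p
  proof -
    obtain q where q: "q \<in> J" "a q \<le> a p + 1" "a p + 1 < a q + 1"
      using tiling[of "a p + 1"] by blast
    \<comment> \<open>If the interval \<open>q\<close> covering \<open>a p + 1\<close> started
      earlier than that point, its left end would lie in the interval \<open>p\<close>; but
      \<open>p\<close> does not contain \<open>a p + 1\<close>, so \<open>q\<close> and
      \<open>p\<close> differ.\<close>
    then have "\<not> a q < a p + 1"
      using uniq[OF p q(1), of "a q"] q by (smt (verit))
    with q show ?thesis by force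
  qed
  have upn: "\<exists>q\<in>J. a q = a p + real n" if p: "p \<in> J" for p n
  proof (induction n)
    case 0
    then show ?case using p by auto
  next
    case (Suc n)
    then obtain q where "q \<in> J" "a q = a p + real n" by blast
    with up[of q] show ?case by force
  qed
  have main: "a p - a q \<in> \<int>" if pq: "p \<in> J" "q \<in> J" "a q \<le> a p" for p q
  proof -
    define n where "n = nat \<lfloor>a p - a q\<rfloor>"
    have n: "real n \<le> a p - a q" "a p - a q < real n + 1"
      using pq(3) unfolding n_def by linarith+
    obtain r where r: "r \<in> J" "a r = a q + real n"
      using upn[OF pq(2)] by blast
    then have "r = p"
      using uniq[of r p "a p"] pq n by force
    with r show ?thesis by simp
  qed
  show ?thesis
  proof (cases "a j' \<le> a j")
    case True
    with main assms show ?thesis by blast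
  next
    case False
    then have "a j' - a j \<in> \<int>"
      using main assms by force
    then show ?thesis
      using Ints_minus by fastforce
  qed
qed

text \<open>A line parallel to the \<open>i\<close>-th axis meets only cubes whose \<open>i\<close>-th coordinates are congruent modulo 1,
  so shifting one congruence class along that axis moves either all or none of the intervals on the line.\<close>
lemma exact_tiling_shift_class:
  fixes \<phi> :: "'j \<Rightarrow> real^'n"
  assumes "exact_tiling \<phi> J"
  shows "exact_tiling (\<lambda>j. if \<phi> j $ i - c \<in> \<int> then \<phi> j + s *\<^sub>R axis i 1 else \<phi> j) J"
    (is "exact_tiling ?\<psi> J")
  unfolding exact_tiling_def
proof
  fix x :: "real^'n"
  define L where "L = {j \<in> J. \<forall>k. k \<noteq> i \<longrightarrow> \<phi> j $ k \<le> x $ k \<and> x $ k < \<phi> j $ k + 1}"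
  have psi: "?\<psi> j $ k = \<phi> j $ k + (if k = i \<and> \<phi> j $ i - c \<in> \<int> then s else 0)" for j k
    by (auto simp: axis_def)
  have line: "\<exists>!j. j \<in> L \<and> \<phi> j $ i \<le> u \<and> u < \<phi> j $ i + 1" for u
  proof -
    have "(j \<in> J \<and> (\<forall>k. \<phi> j $ k \<le> (\<chi> k. if k = i then u else x $ k) $ k
        \<and> (\<chi> k. if k = i then u else x $ k) $ k < \<phi> j $ k + 1))
        \<longleftrightarrow> (j \<in> L \<and> \<phi> j $ i \<le> u \<and> u < \<phi> j $ i + 1)" for j
      by (auto simp: L_def)
    then show ?thesis
      using assms[unfolded exact_tiling_def, rule_format, of "\<chi> k. if k = i then u else x $ k"]
      by (simp only:)
  qed
  have cong: "\<phi> j $ i - \<phi> j' $ i \<in> \<int>" if "j \<in> L" "j' \<in> L" for j j'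
    using unit_interval_tiling_congruent[of L "\<lambda>j. \<phi> j $ i"] line that by blast
  obtain j0 where j0: "j0 \<in> L"
    using line by blast
  \<comment> \<open>One cube met by the line decides for all of them, so the new tiling of the line
    is the old one translated by \<open>s'\<close>.\<close>
  define s' where "s' = (if \<phi> j0 $ i - c \<in> \<int> then s else 0)"
  have s': "?\<psi> j $ i = \<phi> j $ i + s'" if "j \<in> L" for j
  proof -
    have "\<phi> j $ i - c \<in> \<int> \<longleftrightarrow> \<phi> j0 $ i - c \<in> \<int>"
      using Ints_add[OF cong[OF that j0]] Ints_add[OF cong[OF j0 that]] by fastforce
    then show ?thesis by (simp add: psi s'_def)
  qed
  have "(j \<in> J \<and> (\<forall>k. ?\<psi> j $ k \<le> x $ k \<and> x $ k < ?\<psi> j $ k + 1))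
      \<longleftrightarrow> (j \<in> L \<and> ?\<psi> j $ i \<le> x $ i \<and> x $ i < ?\<psi> j $ i + 1)" for j
    unfolding L_def psi by auto
  also have "\<dots> j \<longleftrightarrow> j \<in> L \<and> \<phi> j $ i \<le> x $ i - s' \<and> x $ i - s' < \<phi> j $ i + 1" for j
    using s'[of j] by auto
  finally show "\<exists>!j. j \<in> J \<and> (\<forall>k. ?\<psi> j $ k \<le> x $ k \<and> x $ k < ?\<psi> j $ k + 1)"
    using line[of "x $ i - s'"] by (simp only:)
qed

text \<open>Induction on the number of coordinates in which the two cubes differ. If they differ in
  coordinate \<open>i\<close> by a non-integer, shifting the congruence class of \<open>q\<close>
  makes them agree there and changes no other coordinate. The process cannot end with equal
  translations, since the shifted family still tiles.\<close>

theorem Keller: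
  fixes \<phi> :: "'j \<Rightarrow> real^'n"
  assumes "exact_tiling \<phi> J" "p \<in> J" "q \<in> J" "p \<noteq> q"
  shows "\<exists>i. \<phi> p $ i - \<phi> q $ i \<in> \<int> \<and> \<phi> p $ i \<noteq> \<phi> q $ i"
  using assms(1)
proof (induction "card {i. \<phi> p $ i \<noteq> \<phi> q $ i}" arbitrary: \<phi> rule: less_induct)
  case less
  show ?case
  proof (cases "\<exists>i. \<phi> p $ i \<noteq> \<phi> q $ i")
    case False
    then have "\<phi> p = \<phi> q" by (simp add: vec_eq_iff)
    \<comment> \<open>Distinct cubes in the same place would both contain their common
      corner.\<close>
    then show ?thesis
      using less.prems[unfolded exact_tiling_def, rule_format, of "\<phi> p"] assms
      by (metis dual_order.refl less_add_one)
  next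
    case True
    then obtain i where i: "\<phi> p $ i \<noteq> \<phi> q $ i" by blast
    show ?thesis
    proof (cases "\<phi> p $ i - \<phi> q $ i \<in> \<int>")
      case True
      with i show ?thesis by blast
    next
      case False
      \<comment> \<open>This amount moves \<open>q\<close> level with \<open>p\<close> in coordinate
        \<open>i\<close>, while \<open>p\<close> is not in the class that moves. The coordinate
        obtained for \<open>\<psi>\<close> cannot be \<open>i\<close>, so it serves for
        \<open>\<phi>\<close> as well.\<close>
      define \<psi> where "\<psi> j = (if \<phi> j $ i - \<phi> q $ i \<in> \<int>
        then \<phi> j + (\<phi> p $ i - \<phi> q $ i) *\<^sub>R axis i 1 else \<phi> j)" for j
      have tiling: "exact_tiling \<psi> J"
        unfolding \<psi>_def by (rule exact_tiling_shift_class[OF less.prems])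
      have psi: "\<psi> p = \<phi> p" "\<psi> q $ k = (if k = i then \<phi> p $ i else \<phi> q $ k)" for k
        using False by (auto simp: \<psi>_def axis_def)
      have "{k. \<psi> p $ k \<noteq> \<psi> q $ k} \<subset> {k. \<phi> p $ k \<noteq> \<phi> q $ k}"
        using i by (auto simp: psi split: if_splits)
      then have "card {k. \<psi> p $ k \<noteq> \<psi> q $ k} < card {k. \<phi> p $ k \<noteq> \<phi> q $ k}"
        by (intro psubset_card_mono) auto
      from less.hyps[OF this tiling] show ?thesis
        by (auto simp: psi split: if_splits)
    qed
  qed
qed

section \<open>From tilings up to null sets to exact tilings\<close>

lemma open_subset_null_set_empty:
  fixes U :: "'a::euclidean_space set"
  assumes "open U" "U \<subseteq> S" "S \<in> null_sets lebesgue"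
  shows "U = {}"
  using assms negligible_iff_null_sets negligible_subset open_not_negligible by metis

text \<open>Half-open cubes that meet have an open box in common: in each coordinate the larger left
  end lies strictly below the smaller right end.\<close>

lemma unit_cube_packing_disjoint:
  fixes t t' :: "real^'n"
  assumes "((\<lambda>x. x + t) ` unit_cube \<inter> (\<lambda>x. x + t') ` unit_cube) \<in> null_sets lebesgue"
  shows "(\<lambda>x. x + t) ` unit_cube \<inter> (\<lambda>x. x + t') ` unit_cube = {}"
proof -
  define a b where "a = (\<chi> i. max (t $ i) (t' $ i))" and "b = (\<chi> i. min (t $ i) (t' $ i) + 1)"
  have "box a b \<subseteq> (\<lambda>x. x + t) ` unit_cube \<inter> (\<lambda>x. x + t') ` unit_cube"
    unfolding subset_iff Int_iff mem_translate_unit_cube mem_box_cart a_def b_def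
    by (auto simp: less_imp_le) (metis add_le_cancel_right min.cobounded1 min.cobounded2 order_less_le_trans)+
  then have "box a b = {}"
    using open_subset_null_set_empty[OF open_box _ assms] by blast
  then obtain i where "b $ i \<le> a $ i"
    by (auto simp: interval_eq_empty_cart)
  then have "min (t $ i) (t' $ i) + 1 \<le> max (t $ i) (t' $ i)"
    by (simp add: a_def b_def)
  then show ?thesis
    unfolding set_eq_iff Int_iff mem_translate_unit_cube
    by (smt (verit) empty_iff)
qed

lemma finite_vec:
  assumes "finite A"
  shows "finite {v::'a^'n. \<forall>i. v $ i \<in> A}"
proof -
  have "{v::'a^'n. \<forall>i. v $ i \<in> A} \<subseteq> (\<lambda>f. \<chi> i. f i) ` (UNIV \<rightarrow>\<^sub>E A)"
    by (auto simp: image_iff intro!: bexI[where x="vec_nth _"])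
  then show ?thesis
    using assms by (meson finite_PiE finite finite_imageI finite_subset)
qed

text \<open>Every cube close to \<open>x\<close> contains a point \<open>x + v\<close> with all \<open>v $ i = \<plusminus>1/2\<close>, so only finitely many
  cubes of a packing are close to \<open>x\<close>; hence the complement contains a small box at each of its points.\<close>
lemma tile_exact:
  fixes T :: "(real^'n) set"
  assumes "is_tile unit_cube T"
  shows "exact_tiling (\<lambda>t. t) T"
  unfolding exact_tiling_def
proof
  fix x :: "real^'n"
  have disj: "(\<lambda>x. x + t) ` unit_cube \<inter> (\<lambda>x. x + t') ` unit_cube = {}"
    if "t \<in> T" "t' \<in> T" "t \<noteq> t'" for t t'
    using assms that unit_cube_packing_disjoint unfolding is_tile_def by blast
  then have uniq: "t = t'" if "t \<in> T" "t' \<in> T" "\<forall>i. t $ i \<le> y $ i \<and> y $ i < t $ i + 1"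
     "\<forall>i. t' $ i \<le> y $ i \<and> y $ i < t' $ i + 1" for t t' y
    using that unfolding mem_translate_unit_cube[symmetric] by blast
  \<comment> \<open>The window holds every cube that meets the open box from \<open>x\<close> to
    \<open>x + e\<close> for \<open>e < 1/2\<close>, and it is narrow enough for each of its cubes
    to contain a point \<open>x + v\<close>.\<close>
  define N where "N = {t \<in> T. \<forall>i. x $ i - 3/2 < t $ i \<and> t $ i \<le> x $ i + 1/2}"
  \<comment> \<open>Inside the window, an edge starting at or before \<open>x $ i - 1/2\<close>
    contains \<open>x $ i - 1/2\<close>, and one starting later contains
    \<open>x $ i + 1/2\<close>.\<close>
  define h where "h t = (\<chi> i. if t $ i \<le> x $ i - 1/2 then - (1/2::real) else 1/2)" for t
  have "inj_on h N"
  proof (rule inj_onI)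
    fix t t' assume t: "t \<in> N" "t' \<in> N" and h: "h t = h t'"
    have "\<forall>i. t $ i \<le> (x + h t) $ i \<and> (x + h t) $ i < t $ i + 1" if "t \<in> N" for t
    proof
      fix i
      have "x $ i - 3/2 < t $ i" "t $ i \<le> x $ i + 1/2" using that by (auto simp: N_def)
      then show "t $ i \<le> (x + h t) $ i \<and> (x + h t) $ i < t $ i + 1"
        by (auto simp: h_def)
    qed
    from this[OF t(1)] this[OF t(2)] show "t = t'"
      using uniq[of t t' "x + h t"] t by (auto simp: N_def h)
  qed
  moreover have "h ` N \<subseteq> {v. \<forall>i. v $ i \<in> {-(1/2), 1/2}}"
    by (simp add: h_def image_subset_iff)
  ultimately have finN: "finite N"
    using finite_vec[where 'n='n, of "{-(1/2), 1/2::real}"]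
    by (meson finite.emptyI finite.insertI inj_on_finite)
  have "\<exists>t\<in>T. \<forall>i. t $ i \<le> x $ i \<and> x $ i < t $ i + 1"
  proof (rule ccontr)
    assume *: "\<not> ?thesis"
    \<comment> \<open>In some coordinate a cube that misses \<open>x\<close> starts beyond
      \<open>x\<close> or has ended by \<open>x\<close>. As cubes are half-open, either way it also
      misses a small open box whose lower corner is \<open>x\<close>.\<close>
    have "\<forall>t\<in>N. \<forall>\<^sub>F e in at_right 0. \<exists>j. x $ j + e < t $ j \<or> t $ j + 1 \<le> x $ j"
    proof
      fix t assume "t \<in> N"
      then obtain j where "x $ j < t $ j \<or> t $ j + 1 \<le> x $ j"
        using * unfolding N_def by (metis (no_types, lifting) linorder_not_le mem_Collect_eq)
      then show "\<forall>\<^sub>F e in at_right 0. \<exists>j. x $ j + e < t $ j \<or> t $ j + 1 \<le> x $ j"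
      proof
        assume j: "x $ j < t $ j"
        have "\<forall>\<^sub>F e in at_right 0. e < t $ j - x $ j"
          using j by (simp add: eventually_at_right_less order_tendstoD(2)[OF tendsto_ident_at])
        then show ?thesis by eventually_elim (auto intro!: exI[of _ j])
      qed (auto intro: always_eventually)
    qed
    then have "\<forall>\<^sub>F e in at_right 0. \<forall>t\<in>N. \<exists>j. x $ j + e < t $ j \<or> t $ j + 1 \<le> x $ j"
      using finN by (simp add: eventually_ball_finite)
    moreover have "\<forall>\<^sub>F e in at_right (0::real). e < 1/2"
      by (rule order_tendstoD(2)[OF tendsto_ident_at]) simp
    moreover have "\<forall>\<^sub>F e in at_right (0::real). 0 < e"
      by (rule eventually_at_right_less)
    ultimately have "\<forall>\<^sub>F e in at_right (0::real). 0 < e \<and> e < 1/2 \<and>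
        (\<forall>t\<in>N. \<exists>j. x $ j + e < t $ j \<or> t $ j + 1 \<le> x $ j)"
      by eventually_elim auto
    then obtain e where e: "0 < e" "e < 1/2"
      and far: "\<forall>t\<in>N. \<exists>j. x $ j + e < t $ j \<or> t $ j + 1 \<le> x $ j"
      by (elim eventually_happens'[OF trivial_limit_at_right_real, THEN exE] conjE)
    have "box x (\<chi> i. x $ i + e) \<subseteq> UNIV - (\<Union>t\<in>T. (\<lambda>x. x + t) ` unit_cube)"
    proof
      fix y assume "y \<in> box x (\<chi> i. x $ i + e)"
      then have y: "x $ i < y $ i" "y $ i < x $ i + e" for i
        by (auto simp: mem_box_cart)
      have False if t: "t \<in> T" "\<forall>i. t $ i \<le> y $ i \<and> y $ i < t $ i + 1" for t
      proof -
        have ti: "t $ i \<le> y $ i" "y $ i < t $ i + 1" for i using t by auto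
        have "x $ i - 3/2 < t $ i \<and> t $ i \<le> x $ i + 1/2" for i
          using ti[of i] y[of i] e by linarith
        then have "t \<in> N" using t by (auto simp: N_def)
        then obtain j where "x $ j + e < t $ j \<or> t $ j + 1 \<le> x $ j"
          using far by blast
        then show False using ti[of j] y[of j] by linarith
      qed
      then show "y \<in> UNIV - (\<Union>t\<in>T. (\<lambda>x. x + t) ` unit_cube)"
        unfolding Diff_iff UN_iff mem_translate_unit_cube by blast
    qed
    then have "box x (\<chi> i. x $ i + e) = {}"
      by (rule open_subset_null_set_empty[OF open_box]) (use assms in \<open>simp add: is_tile_def\<close>)
    then show False
      using e by (auto simp: interval_eq_empty_cart)
  qed
  then show "\<exists>!t. t \<in> T \<and> (\<forall>i. t $ i \<le> x $ i \<and> x $ i < t $ i + 1)"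
    using uniq by blast
qed

section \<open>Fourier transform of the unit cube\<close>


text \<open>Integration by parts gives the antiderivative
  \<open>Si (2 * x) - sin x * sinc x\<close>, which vanishes at 0 and has the limit
  \<open>pi/2\<close> of \<open>Si\<close> at infinity. The other half line follows by
  symmetry.\<close>

lemma nn_integral_sinc_square: "(\<integral>\<^sup>+x. ennreal ((sinc x)\<^sup>2) \<partial>lborel) = ennreal pi"
proof -
  define F where "F x = Si (2 * x) - sin x * sinc x" for x
  have Si2: "((\<lambda>x. Si (2 * x)) has_real_derivative sinc (2 * x) * 2) (at x)" for x
    by (rule DERIV_chain2[OF DERIV_Si]) (auto intro!: derivative_eq_intros)
  have deriv: "(F has_real_derivative (sinc x)\<^sup>2) (at x)" for x
  proof (cases "x = 0")
    case True
    \<comment> \<open>The quotient rule fails at 0. There \<open>Si (2 * x)\<close> has derivative 2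
      and \<open>sin x * sinc x\<close> has derivative 1, which leaves
      \<open>1 = (sinc 0)\<^sup>2\<close>.\<close>
    have "((\<lambda>h. sin h * sinc h / h) \<longlongrightarrow> 1) (at 0)"
    proof -
      have "((\<lambda>h. sin h / h * sinc h) \<longlongrightarrow> 1 * sinc 0) (at 0)"
        by (intro tendsto_mult sinc_at_0) (use isCont_sinc[of 0] in \<open>simp add: isCont_def\<close>)
      then show ?thesis by simp
    qed
    then have 2: "((\<lambda>x. sin x * sinc x) has_real_derivative 1) (at x)"
      by (simp add: DERIV_def True if_distrib[of "\<lambda>t. _ * t"] cong: if_cong)
    show ?thesis
      unfolding F_def[abs_def] using DERIV_diff[OF Si2 2] by (simp add: True)
  next
    case False
    have "((\<lambda>x. sin x * (sin x / x)) has_real_derivative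
        cos x * (sin x / x) + (cos x * x - sin x * 1) / (x * x) * sin x) (at x)"
      by (intro DERIV_mult DERIV_divide DERIV_sin DERIV_ident False)
    then have 2: "((\<lambda>x. sin x * sinc x) has_real_derivative
        cos x * (sin x / x) + (cos x * x - sin x * 1) / (x * x) * sin x) (at x)"
      by (rule has_field_derivative_transform_within_open[where S="-{0}"]) (use False in auto)
    have "sinc (2 * x) * 2 - (cos x * (sin x / x) + (cos x * x - sin x * 1) / (x * x) * sin x) = (sinc x)\<^sup>2"
      using False by (simp add: sin_double divide_simps) (simp add: algebra_simps power2_eq_square)
    then show ?thesis
      unfolding F_def[abs_def] using DERIV_diff[OF Si2 2] by simp
  qed
  have "((\<lambda>x. sin x * sinc x) \<longlongrightarrow> 0) at_top"
  proof (rule Lim_null_comparison)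
    show "\<forall>\<^sub>F x in at_top. norm (sin x * sinc x) \<le> 1 / x"
      using eventually_gt_at_top[of 0]
    proof eventually_elim
      case (elim x)
      have "\<bar>sin x * sin x\<bar> \<le> 1"
        by (metis abs_mult abs_ge_zero abs_sin_le_one mult_le_one)
      with elim show ?case by (simp add: abs_mult divide_right_mono)
    qed
  qed (real_asymp)
  moreover have "((\<lambda>x. Si (2 * x)) \<longlongrightarrow> pi/2) at_top"
    by (rule filterlim_compose[OF Si_at_top]) real_asymp
  ultimately have "(F \<longlongrightarrow> pi/2 - 0) at_top"
    unfolding F_def[abs_def] by (intro tendsto_diff)
  then have lim: "(F \<longlongrightarrow> pi/2) at_top" by simp
  have half: "(\<integral>\<^sup>+x. ennreal ((sinc x)\<^sup>2) * indicator {0..} x \<partial>lborel) = ennreal (pi/2)"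
    using nn_integral_FTC_atLeast[OF _ deriv _ lim, of 0] by (simp add: F_def Si_def zero_ereal_def)
  have "(\<integral>\<^sup>+x. ennreal ((sinc x)\<^sup>2) * indicator {..0} x \<partial>lborel)
      = ennreal \<bar>-1\<bar> * (\<integral>\<^sup>+x. ennreal ((sinc (0 + -1 * x))\<^sup>2) * indicator {..0} (0 + -1 * x) \<partial>lborel)"
    by (rule nn_integral_real_affine) auto
  also have "\<dots> = (\<integral>\<^sup>+x. ennreal ((sinc x)\<^sup>2) * indicator {0..} x \<partial>lborel)"
    unfolding abs_minus abs_one ennreal_1 mult_1
    by (intro nn_integral_cong) (auto simp: indicator_def)
  finally have half': "(\<integral>\<^sup>+x. ennreal ((sinc x)\<^sup>2) * indicator {..0} x \<partial>lborel) = ennreal (pi/2)"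
    using half by simp
  have "(\<integral>\<^sup>+x. ennreal ((sinc x)\<^sup>2) \<partial>lborel) = (\<integral>\<^sup>+x. ennreal ((sinc x)\<^sup>2) * indicator {..0} x
      + ennreal ((sinc x)\<^sup>2) * indicator {0..} x \<partial>lborel)"
    using AE_lborel_singleton[of 0] by (intro nn_integral_cong_AE) (auto simp: indicator_def)
  also have "\<dots> = ennreal (pi/2) + ennreal (pi/2)"
    by (subst nn_integral_add) (auto simp: half half')
  also have "\<dots> = ennreal pi"
    by (subst ennreal_plus[symmetric]) auto
  finally show ?thesis .
qed

lemma nn_integral_normalised_sinc_square:
  "(\<integral>\<^sup>+x. ennreal ((sinc (pi * x))\<^sup>2) \<partial>lborel) = 1"
proof -
  have "(\<integral>\<^sup>+x. ennreal ((sinc x)\<^sup>2) \<partial>lborel)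
      = ennreal \<bar>pi\<bar> * (\<integral>\<^sup>+x. ennreal ((sinc (0 + pi * x))\<^sup>2) \<partial>lborel)"
    by (rule nn_integral_real_affine) auto
  then have "ennreal pi * 1 = pi * (\<integral>\<^sup>+x. ennreal ((sinc (pi * x))\<^sup>2) \<partial>lborel)"
    unfolding nn_integral_sinc_square by (simp only: add_0 mult_1_right abs_of_pos pi_gt_zero)
  then show ?thesis
    by (subst (asm) ennreal_mult_cancel_left) auto
qed

section \<open>Product integrals and the transform of the cube\<close>

lemma Basis_vec_real: "(Basis :: (real^'n) set) = (\<lambda>i. axis i 1) ` UNIV"
  by (auto simp: Basis_vec_def)

lemma inj_axis_1: "inj (\<lambda>i. axis i (1::real))"
  by (simp add: inj_def axis_eq_axis)

lemma integral_lborel_prod_vec: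
  fixes f :: "'n::finite \<Rightarrow> real \<Rightarrow> complex"
  assumes "\<And>i. integrable lborel (f i)"
  shows "(\<integral>x. (\<Prod>i\<in>UNIV. f i (x $ i)) \<partial>(lborel :: (real^'n) measure)) = (\<Prod>i\<in>UNIV. \<integral>t. f i t \<partial>lborel)"
proof -
  interpret product_sigma_finite "\<lambda>_::real^'n. lborel :: real measure" ..
  \<comment> \<open>The product measure is indexed by basis vectors, so the factors are carried from
    \<open>i\<close> to \<open>axis i 1\<close>.\<close>
  define g where "g b = f (the_inv (\<lambda>i. axis i 1) b)" for b :: "real^'n"
  have g: "g (axis i 1) = f i" for i
    by (simp add: g_def the_inv_f_f[OF inj_axis_1])
  have [measurable]: "f i \<in> borel_measurable borel" for i
    using borel_measurable_integrable[OF assms] by simp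
  have [measurable]: "(\<lambda>x. \<Prod>i\<in>UNIV. f i (x $ i)) \<in> borel_measurable (borel :: (real^'n) measure)"
    by measurable
  have "(\<integral>x. (\<Prod>i\<in>UNIV. f i (x $ i)) \<partial>(lborel :: (real^'n) measure))
    = (\<integral>x. (\<Prod>i\<in>UNIV. f i ((\<Sum>b\<in>Basis. x b *\<^sub>R b) $ i)) \<partial>(\<Pi>\<^sub>M b\<in>(Basis::(real^'n) set). lborel))"
    by (subst lborel_eq, subst integral_distr) auto
  also have "\<dots> = (\<integral>x. (\<Prod>b\<in>Basis. g b (x b)) \<partial>(\<Pi>\<^sub>M b\<in>(Basis::(real^'n) set). lborel))"
  proof (intro Bochner_Integration.integral_cong refl)
    fix x :: "real^'n \<Rightarrow> real"
    have "(\<Sum>b\<in>Basis. x b *\<^sub>R b) $ i = x (axis i 1)" for i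
      by (subst cart_eq_inner_axis, subst inner_sum_left_Basis) (auto simp: Basis_vec_real)
    then show "(\<Prod>i\<in>UNIV. f i ((\<Sum>b\<in>Basis. x b *\<^sub>R b) $ i)) = (\<Prod>b\<in>Basis. g b (x b))"
      by (simp add: Basis_vec_real prod.reindex[OF inj_axis_1] g)
  qed
  also have "\<dots> = (\<Prod>b\<in>Basis. \<integral>t. g b t \<partial>lborel)"
    by (rule product_integral_prod) (auto simp: Basis_vec_real g assms)
  also have "\<dots> = (\<Prod>i\<in>UNIV. \<integral>t. f i t \<partial>lborel)"
    by (simp add: Basis_vec_real prod.reindex[OF inj_axis_1] g)
  finally show ?thesis .
qed

lemma nn_integral_lborel_prod_vec:
  fixes f :: "real \<Rightarrow> ennreal"
  assumes "f \<in> borel_measurable borel"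
  shows "(\<integral>\<^sup>+x. (\<Prod>i\<in>UNIV. f (x $ i)) \<partial>(lborel :: (real^'n) measure)) = (\<integral>\<^sup>+t. f t \<partial>lborel) ^ CARD('n)"
  using nn_integral_lborel_prod[where 'a="real^'n", of "\<lambda>_. f"] assms
  by (simp add: Basis_vec_real prod.reindex[OF inj_axis_1] card_image[OF inj_axis_1] cart_eq_inner_axis[symmetric])

text \<open>The exponent has a positive sign, so this is the usual Fourier transform of the cube at
  \<open>- z\<close>; the inner product of \<open>expo l\<close> and \<open>expo m\<close> is then
  its value at \<open>l - m\<close>.\<close>

definition cube_FT :: "real^'n \<Rightarrow> complex" where
  "cube_FT z = (\<integral>x. indicator unit_cube x * expo z x \<partial>lborel)"

lemma interval_exp_integral:
  fixes z :: real
  assumes "z \<noteq> 0"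
  shows "(\<integral>t. indicator {0..<1} t * exp (\<i> * complex_of_real (2 * pi * z * t)) \<partial>lborel)
    = (exp (\<i> * complex_of_real (2 * pi * z)) - 1) / (\<i> * complex_of_real (2 * pi * z))"
proof -
  define c where "c = \<i> * complex_of_real (2 * pi * z)"
  have c: "c \<noteq> 0" using assms by (simp add: c_def)
  have "(\<integral>t. indicator {0..<1} t * exp (c * complex_of_real t) \<partial>lborel)
      = (\<integral>t. indicator {0..1::real} t *\<^sub>R exp (c * complex_of_real t) \<partial>lborel)"
    using AE_lborel_singleton[of "1::real"]
    by (intro integral_cong_AE) (auto simp: indicator_def)
  also have "\<dots> = exp (c * complex_of_real 1) / c - exp (c * complex_of_real 0) / c"
    by (rule integral_FTC_Icc)
      (auto intro!: derivative_eq_intros continuous_intros has_vector_derivative_real_field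
        simp: c)
  finally show ?thesis by (simp add: c_def diff_divide_distrib mult_ac)
qed

lemma integrable_indicator_exp:
  fixes z :: real
  shows "integrable lborel (\<lambda>t. indicator {0..<1} t * exp (\<i> * complex_of_real (2 * pi * z * t)))"
proof -
  have "integrable lborel (\<lambda>t. indicator {0..<1::real} t *\<^sub>R exp (\<i> * complex_of_real (2 * pi * z * t)))"
    by (rule integrableI_bounded_set_indicator[where B=1]) auto
  then show ?thesis
    by (rule Bochner_Integration.integrable_cong[THEN iffD1, rotated 2]) (auto simp: indicator_def)
qed

lemma indicator_unit_cube: "indicator unit_cube x = (\<Prod>i\<in>UNIV. indicator {0..<1} (x $ i) :: 'a::{comm_semiring_1})"
proof (cases "x \<in> unit_cube")
  case True
  then show ?thesis by (simp add: unit_cube_def)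
next
  case False
  then obtain i where "x $ i \<notin> {0..<1}" by (auto simp: unit_cube_def)
  then have "(\<Prod>i\<in>UNIV. indicator {0..<1} (x $ i) :: 'a) = 0"
    by (intro prod_zero) (auto intro!: exI[of _ i])
  with False show ?thesis by simp
qed

lemma expo_prod: "expo z x = (\<Prod>i\<in>UNIV. exp (\<i> * complex_of_real (2 * pi * z $ i * x $ i)))"
  by (simp add: expo_def inner_vec_def exp_sum[symmetric] sum_distrib_left mult_ac)

lemma cube_FT_prod:
  fixes z :: "real^'n"
  shows "cube_FT z = (\<Prod>i\<in>UNIV. \<integral>t. indicator {0..<1} t * exp (\<i> * complex_of_real (2 * pi * z $ i * t)) \<partial>lborel)"
  unfolding cube_FT_def indicator_unit_cube expo_prod prod.distrib[symmetric]
  by (rule integral_lborel_prod_vec) (rule integrable_indicator_exp)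

text \<open>For nonzero \<open>z\<close> the numerator of the integral is a chord of the unit circle
  spanning the angle \<open>2 * pi * z\<close>, of length
  \<open>2 * \<bar>sin (pi * z)\<bar>\<close>.\<close>

lemma cmod_interval_exp_integral:
  fixes z :: real
  shows "cmod (\<integral>t. indicator {0..<1} t * exp (\<i> * complex_of_real (2 * pi * z * t)) \<partial>lborel) = \<bar>sinc (pi * z)\<bar>"
proof (cases "z = 0")
  case True
  have "(\<integral>t. indicator {0..<1::real} t * (1::complex) \<partial>lborel) = (\<integral>t. complex_of_real (indicator {0..<1::real} t) \<partial>lborel)"
    by (intro Bochner_Integration.integral_cong) (auto simp: indicator_def)
  also have "\<dots> = 1"
    by (subst integral_complex_of_real) simp
  finally show ?thesis using True by simp
next
  case False
  have "cmod (exp (\<i> * complex_of_real (2 * pi * z)) - 1) = 2 * \<bar>sin (2 * pi * z / 2)\<bar>"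
    using dist_exp_i_1[of "2*pi*z"] by simp
  then have "cmod (\<integral>t. indicator {0..<1} t * exp (\<i> * complex_of_real (2 * pi * z * t)) \<partial>lborel)
     = 2 * \<bar>sin (pi * z)\<bar> / \<bar>2 * pi * z\<bar>"
    unfolding interval_exp_integral[OF False] norm_divide by (simp add: norm_mult abs_mult)
  then show ?thesis using False by (simp add: abs_mult)
qed

lemma cmod_cube_FT: "cmod (cube_FT z) = (\<Prod>i\<in>UNIV. \<bar>sinc (pi * z $ i)\<bar>)"
  unfolding cube_FT_prod prod_norm[symmetric] cmod_interval_exp_integral ..

text \<open>A product of sinc factors vanishes iff one factor does, and \<open>sinc (pi * t)\<close>
  vanishes exactly at the nonzero integers. Through this, orthogonality becomes the difference
  condition.\<close>

lemma cube_FT_eq_0_iff: "cube_FT z = 0 \<longleftrightarrow> z \<in> Z_cube"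
proof -
  have sinc: "\<bar>sinc (pi * t)\<bar> = 0 \<longleftrightarrow> t \<in> \<int> \<and> t \<noteq> 0" for t
    using sin_times_pi_eq_0[of t] by (auto simp: mult.commute)
  have "cube_FT z = 0 \<longleftrightarrow> cmod (cube_FT z) = 0"
    by (rule norm_eq_zero[symmetric])
  also have "\<dots> \<longleftrightarrow> (\<exists>i\<in>UNIV. \<bar>sinc (pi * z $ i)\<bar> = 0)"
    unfolding cmod_cube_FT by (rule prod_zero_iff) simp
  also have "\<dots> \<longleftrightarrow> z \<in> Z_cube"
    unfolding sinc Z_cube_def by (auto simp: vec_eq_iff)
  finally show ?thesis .
qed

text \<open>The square factors over the coordinates, each factor having integral 1. Hence the
  function can replace the indicator of the cube in the packing argument.\<close>

lemma nn_integral_cube_FT_square: "(\<integral>\<^sup>+z. ennreal ((cmod (cube_FT z))\<^sup>2) \<partial>(lborel :: (real^'n) measure)) = 1"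
proof -
  have "ennreal ((cmod (cube_FT z))\<^sup>2) = (\<Prod>i\<in>UNIV. ennreal ((sinc (pi * z $ i))\<^sup>2))" for z :: "real^'n"
    unfolding cmod_cube_FT prod_power_distrib power2_abs by (rule prod_ennreal[symmetric]) simp
  then show ?thesis
    using nn_integral_lborel_prod_vec[where 'n='n, of "\<lambda>t. ennreal ((sinc (pi * t))\<^sup>2)"]
      nn_integral_normalised_sinc_square by simp
qed

lemma borel_measurable_cmod_cube_FT [measurable]: "(\<lambda>z. cmod (cube_FT z)) \<in> borel_measurable borel"
  unfolding cmod_cube_FT[abs_def] by measurable

section \<open>Lattices and periodization\<close>


text \<open>Unlike \<open>measure_linear_image\<close>, this does not ask for a well-order on the index type.\<close>
lemma measure_linear_image_vec:
  fixes f :: "real^'n \<Rightarrow> real^'n"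
  assumes "linear f" "S \<in> lmeasurable"
  shows "f ` S \<in> lmeasurable \<and> measure lebesgue (f ` S) = \<bar>det (matrix f)\<bar> * measure lebesgue S"
proof -
  define P where "P f \<longleftrightarrow> (\<forall>S\<in>lmeasurable. f ` S \<in> lmeasurable \<and>
      measure lebesgue (f ` S) = \<bar>det (matrix f)\<bar> * measure lebesgue S)" for f :: "real^'n \<Rightarrow> real^'n"
  \<comment> \<open>For maps of determinant 1 or -1 it is enough that the volume of boxes is
    preserved; this serves for coordinate swaps and shears.\<close>
  have boxes: "P h" if lin: "linear h" and det: "\<bar>det (matrix h)\<bar> = 1"
    and "\<And>a b. cbox a b \<noteq> {} \<Longrightarrow> measure lebesgue (h ` cbox a b) = measure lebesgue (cbox a b)" for h
  proof -
    have "measure lebesgue (h ` cbox a b) = 1 * measure lebesgue (cbox a b)" for a b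
      using that(3)[of a b] by (cases "cbox a b = {}") (simp_all only: image_empty mult_1 not_False_eq_True)
    then show ?thesis
      unfolding P_def det mult_1 using measure_linear_sufficient[OF lin, of _ 1] by (metis mult_1)
  qed
  have "P f"
  proof (rule induct_linear_elementary[OF assms(1)])
    fix f g :: "real^'n \<Rightarrow> real^'n"
    assume "linear f" "linear g" "P f" "P g"
    then show "P (f \<circ> g)"
      unfolding P_def image_comp[symmetric] by (simp add: matrix_compose det_mul abs_mult)
  next
    fix f :: "real^'n \<Rightarrow> real^'n" and i
    assume f: "linear f" "\<And>x. f x $ i = 0"
    \<comment> \<open>The image lies in a coordinate hyperplane, so both sides of the formula are
      0.\<close>
    then have "\<not> surj f"
      by (metis surjD zero_neq_one vec_component)
    then have "\<not> inj f"
      using f(1) linear_injective_imp_surjective by blast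
    then have "det (matrix f) = 0" "negligible (f ` S)" for S
      using f(1) det_nz_iff_inj negligible_linear_singular_image by blast+
    then show "P f"
      unfolding P_def using negligible_imp_measurable negligible_imp_measure0 by fastforce
  next
    fix c :: "'n \<Rightarrow> real"
    have "det (matrix (\<lambda>x. \<chi> i. c i * x $ i)) = prod c UNIV"
      by (subst det_diagonal) (simp_all add: matrix_def axis_def)
    then show "P (\<lambda>x. \<chi> i. c i * x $ i)"
      unfolding P_def by (simp add: measurable_stretch measure_stretch)
  next
    fix m n :: 'n
    let ?\<tau> = "Transposition.transpose m n"
    let ?h = "\<lambda>x::real^'n. \<chi> i. x $ ?\<tau> i"
    show "P ?h"
    proof (rule boxes)
      show "linear ?h"
        by (rule linearI) (simp_all add: vec_eq_iff)
      have "matrix ?h = (\<chi> i. mat 1 $ ?\<tau> i)"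
        by (simp add: matrix_def mat_def axis_def vec_eq_iff)
      then show "\<bar>det (matrix ?h)\<bar> = 1"
        by (simp add: det_permute_rows permutes_swap_id sign_swap_id)
      fix a b :: "real^'n"
      assume ne: "cbox a b \<noteq> {}"
      have "?h ` cbox a b = cbox (?h a) (?h b)"
      proof (intro set_eqI iffI)
        fix y assume "y \<in> cbox (?h a) (?h b)"
        then have "\<forall>i. a $ ?\<tau> (?\<tau> i) \<le> y $ ?\<tau> i \<and> y $ ?\<tau> i \<le> b $ ?\<tau> (?\<tau> i)"
          unfolding mem_box_cart vec_lambda_beta by blast
        then show "y \<in> ?h ` cbox a b"
          by (intro image_eqI[where x="?h y"]) (simp_all add: vec_eq_iff mem_box_cart)
      qed (auto simp: mem_box_cart)
      moreover have "(\<Prod>i\<in>UNIV. b $ ?\<tau> i - a $ ?\<tau> i) = (\<Prod>i\<in>UNIV. b $ i - a $ i)"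
        by (rule prod.reindex_bij_betw) simp
      ultimately show "measure lebesgue (?h ` cbox a b) = measure lebesgue (cbox a b)"
        using ne content_cbox_cart[of a b] content_cbox_cart[of "?h a" "?h b"] by auto
    qed
  next
    fix m n :: 'n
    assume mn: "m \<noteq> n"
    let ?h = "\<lambda>x::real^'n. \<chi> i. if i = m then x $ m + x $ n else x $ i"
    show "P ?h"
    proof (rule boxes)
      show lin: "linear ?h"
        by (rule linearI) (simp_all add: vec_eq_iff algebra_simps)
      have "matrix ?h = (\<chi> k. if k = m then row m (mat 1) + 1 *s row n (mat 1) else row k (mat 1))"
        by (auto simp: matrix_def mat_def axis_def vec_eq_iff row_def)
      then show "\<bar>det (matrix ?h)\<bar> = 1"
        by (simp add: det_row_operation[OF mn])
      fix a b :: "real^'n"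
      assume ne: "cbox a b \<noteq> {}"
      \<comment> \<open>The volume formula for a sheared box wants the \<open>n\<close>-th
        coordinate to be nonnegative on the box; this translation makes it start at 0.\<close>
      define v where "v = axis n (- a $ n)"
      have cb: "cbox (v + a) (v + b) = (+) v ` cbox a b"
        by (simp add: cbox_translation)
      have "?h ` cbox a b = (+) (- ?h v) ` ?h ` (+) v ` cbox a b"
        unfolding image_image by (intro image_cong refl) (auto simp: vec_eq_iff)
      then have "measure lebesgue (?h ` cbox a b) = measure lebesgue (?h ` (+) v ` cbox a b)"
        by (simp only: measure_translation)
      also have "\<dots> = measure lebesgue ((+) v ` cbox a b)"
        unfolding cb[symmetric] by (rule measure_shear_interval[OF mn]) (use ne cb in \<open>auto simp: v_def\<close>)
      finally show "measure lebesgue (?h ` cbox a b) = measure lebesgue (cbox a b)"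
        by (simp only: measure_translation)
    qed
  qed
  with assms(2) show ?thesis by (simp add: P_def)
qed


section \<open>Lattices and fundamental domains\<close>

lemma unit_cube_borel [measurable]: "unit_cube \<in> sets (borel :: (real^'n) measure)"
proof -
  have "unit_cube = {x\<in>space (borel :: (real^'n) measure). \<forall>i. 0 \<le> x $ i \<and> x $ i < 1}"
    by (simp add: unit_cube_def)
  also have "\<dots> \<in> sets borel" by measurable
  finally show ?thesis .
qed

lemma lattice_enumeration:
  fixes R :: "real^'n^'n"
  assumes "invertible R"
  obtains l :: "nat \<Rightarrow> real^'n" where "bij_betw l UNIV (lattice R)"
proof -
  have inj: "inj ((*v) R)"
    using assms by (simp add: inj_matrix_vector_mult)
  have lat: "lattice R = (*v) R ` {k. \<forall>i. k $ i \<in> \<int>}"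
    by (auto simp: lattice_def)
  have "countable (\<int> :: real set)"
    by (simp add: Ints_def)
  then have "countable {k::real^'n. \<forall>i. k $ i \<in> \<int>}"
    by (rule countable_vector)
  then have "countable (lattice R)"
    unfolding lat by simp
  moreover have "infinite (lattice R)"
  proof -
    have "inj (\<lambda>n::nat. (\<chi> i. real n) :: real^'n)"
      by (auto simp: inj_def vec_eq_iff)
    then have "infinite (range (\<lambda>n::nat. (\<chi> i. real n) :: real^'n))"
      by (rule range_inj_infinite)
    then have "infinite {k::real^'n. \<forall>i. k $ i \<in> \<int>}"
      by (rule contrapos_nn) (auto elim!: finite_subset[rotated])
    then show ?thesis
      unfolding lat using finite_imageD inj inj_on_subset by blast
  qed
  ultimately show ?thesis
    using that bij_betw_from_nat_into by blast
qed

text \<open>Built from the half-open cube, so that every point has exactly one lattice translate in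
  it, without exceptions on the boundary.\<close>

definition fund_domain :: "real^'n^'n \<Rightarrow> (real^'n) set" where
  "fund_domain R = (*v) R ` unit_cube"

lemma fund_domain_vimage:
  fixes R B :: "real^'n^'n"
  assumes "R ** B = mat 1" "B ** R = mat 1"
  shows "fund_domain R = (*v) B -` unit_cube"
proof -
  have "R *v (B *v x) = x" "B *v (R *v x) = x" for x
    using assms by (simp_all add: matrix_vector_mul_assoc)
  then show ?thesis
    unfolding fund_domain_def by (auto simp: image_iff) (metis)
qed

lemma fund_domain_borel:
  fixes R :: "real^'n^'n"
  assumes "invertible R"
  shows "fund_domain R \<in> sets borel"
proof -
  obtain B where B: "R ** B = mat 1" "B ** R = mat 1"
    using assms by (auto simp: invertible_def)
  have "(*v) B \<in> borel_measurable borel"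
    by (intro borel_measurable_continuous_onI linear_continuous_on matrix_vector_mul_bounded_linear)
  then have "(*v) B -` unit_cube \<inter> space borel \<in> sets borel"
    by (rule measurable_sets) (rule unit_cube_borel)
  then show ?thesis
    by (simp add: fund_domain_vimage[OF B])
qed

lemma unit_cube_floor:
  fixes y :: "real^'n"
  shows "\<exists>!k. (\<forall>i. k $ i \<in> \<int>) \<and> y + k \<in> unit_cube"
proof (rule ex1I[where a="\<chi> i. - of_int \<lfloor>y $ i\<rfloor>"])
  show "(\<forall>i. (\<chi> i. - real_of_int \<lfloor>y $ i\<rfloor>) $ i \<in> \<int>) \<and> y + (\<chi> i. - of_int \<lfloor>y $ i\<rfloor>) \<in> unit_cube"
    by (simp add: unit_cube_def) linarith
  fix k :: "real^'n"
  assume k: "(\<forall>i. k $ i \<in> \<int>) \<and> y + k \<in> unit_cube"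
  show "k = (\<chi> i. - of_int \<lfloor>y $ i\<rfloor>)"
    unfolding vec_eq_iff
  proof
    fix i
    obtain n where n: "k $ i = of_int n" using k by (meson Ints_cases)
    have "0 \<le> y $ i + k $ i" "y $ i + k $ i < 1" using k by (auto simp: unit_cube_def)
    then have "\<lfloor>y $ i\<rfloor> = - n" using n by linarith
    then show "k $ i = (\<chi> i. - of_int \<lfloor>y $ i\<rfloor>) $ i" using n by simp
  qed
qed

text \<open>In coordinates with respect to the columns of \<open>R\<close> this is the splitting of
  a vector into integer and fractional parts.\<close>

lemma fund_domain_unique:
  fixes R :: "real^'n^'n"
  assumes R: "invertible R"
  shows "\<exists>!m. m \<in> lattice R \<and> x + m \<in> fund_domain R"
proof -
  obtain B where B: "R ** B = mat 1" "B ** R = mat 1"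
    using assms by (auto simp: invertible_def)
  have R1: "B *v (R *v k) = k" for k
    using B by (simp add: matrix_vector_mul_assoc)
  obtain k where k: "\<forall>i. k $ i \<in> \<int>" "B *v x + k \<in> unit_cube"
    using unit_cube_floor by blast
  have mem: "x + R *v k \<in> fund_domain R \<longleftrightarrow> B *v x + k \<in> unit_cube" for k
    by (simp add: fund_domain_vimage[OF B] matrix_vector_right_distrib R1)
  show ?thesis
  proof (rule ex1I[where a="R *v k"])
    show "R *v k \<in> lattice R \<and> x + R *v k \<in> fund_domain R"
      using k mem by (auto simp: lattice_def)
    fix m assume m: "m \<in> lattice R \<and> x + m \<in> fund_domain R"
    then obtain k' where k': "m = R *v k'" "\<forall>i. k' $ i \<in> \<int>"
      by (auto simp: lattice_def)
    then have "B *v x + k' \<in> unit_cube" using m mem by auto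
    then have "k' = k" using unit_cube_floor[of "B *v x"] k k' by blast
    then show "m = R *v k" using k' by simp
  qed
qed

lemma emeasure_unit_cube: "emeasure lborel (unit_cube :: (real^'n) set) = 1"
proof (rule antisym)
  have 1: "(1::real^'n) \<bullet> b = 1" if "b \<in> Basis" for b
    using that by (auto simp: Basis_vec_def inner_axis)
  have "emeasure lborel (unit_cube :: (real^'n) set) \<le> emeasure lborel (cbox 0 (1::real^'n))"
    by (intro emeasure_mono) (auto simp: unit_cube_def mem_box_cart less_imp_le)
  also have "\<dots> = 1"
    by (subst emeasure_lborel_cbox) (auto simp: 1)
  finally show "emeasure lborel (unit_cube :: (real^'n) set) \<le> 1" .
  have "1 = emeasure lborel (box 0 (1::real^'n))"
    by (subst emeasure_lborel_box) (auto simp: 1)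
  also have "\<dots> \<le> emeasure lborel (unit_cube :: (real^'n) set)"
    by (intro emeasure_mono) (auto simp: unit_cube_def mem_box_cart less_imp_le)
  finally show "1 \<le> emeasure lborel (unit_cube :: (real^'n) set)" .
qed

lemma emeasure_fund_domain:
  fixes R :: "real^'n^'n"
  assumes "invertible R"
  shows "emeasure lborel (fund_domain R) = ennreal \<bar>det R\<bar>"
proof -
  have cube: "unit_cube \<in> sets (lborel :: (real^'n) measure)" by simp
  have lm: "(unit_cube :: (real^'n) set) \<in> lmeasurable"
    using emeasure_unit_cube[where 'n='n] by (auto intro!: fmeasurableI simp: cube)
  have lin: "linear ((*v) R)" by simp
  have D: "fund_domain R \<in> lmeasurable"
    and "measure lebesgue (fund_domain R) = \<bar>det R\<bar> * measure lebesgue (unit_cube :: (real^'n) set)"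
    unfolding fund_domain_def using measure_linear_image_vec[OF lin lm] by auto
  moreover have "measure lebesgue (unit_cube :: (real^'n) set) = 1"
    using emeasure_unit_cube[where 'n='n] cube by (simp add: measure_def)
  ultimately have "emeasure lebesgue (fund_domain R) = ennreal \<bar>det R\<bar>"
    using D by (simp add: emeasure_eq_measure2)
  then show ?thesis
    using fund_domain_borel[OF assms] by simp
qed

section \<open>Unfolding integrals and packing densities\<close>

lemma nn_integral_lborel_translate:
  fixes g :: "'a::euclidean_space \<Rightarrow> ennreal"
  assumes "g \<in> borel_measurable borel"
  shows "(\<integral>\<^sup>+x. g (x + c) \<partial>lborel) = (\<integral>\<^sup>+x. g x \<partial>lborel)"
proof -
  have "(\<integral>\<^sup>+x. g x \<partial>lborel) = (\<integral>\<^sup>+x. g x \<partial>distr lborel borel ((+) c))"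
    by (simp add: lborel_distr_plus)
  also have "\<dots> = (\<integral>\<^sup>+x. g (c + x) \<partial>lborel)"
    using assms by (subst nn_integral_distr) auto
  finally show ?thesis by (simp add: add.commute)
qed

text \<open>The translates of \<open>D\<close> partition the space, so their indicators sum to 1.
  Inserting this sum cuts the integral into pieces, and each piece is translated back into
  \<open>D\<close>.\<close>

lemma nn_integral_unfold:
  fixes g :: "'a::euclidean_space \<Rightarrow> ennreal" and l :: "nat \<Rightarrow> 'a"
  assumes [measurable]: "g \<in> borel_measurable borel" "D \<in> sets borel"
    and D: "\<And>x. \<exists>!i. x + l i \<in> D"
  shows "(\<integral>\<^sup>+x. g x \<partial>lborel) = (\<integral>\<^sup>+x. (\<Sum>i. g (x - l i)) * indicator D x \<partial>lborel)"
proof -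
  have one: "(\<Sum>i. indicator D (x + l i) :: ennreal) = 1" for x
  proof -
    obtain j where "x + l j \<in> D" "\<forall>i. x + l i \<in> D \<longrightarrow> i = j"
      using D[of x] unfolding Ex1_def by blast
    then have "x + l i \<in> D \<longleftrightarrow> i = j" for i
      by blast
    then have "(\<lambda>i. indicator D (x + l i) :: ennreal) = (\<lambda>i. if i = j then 1 else 0)"
      by (simp add: indicator_def fun_eq_iff)
    then show ?thesis
      by (simp only: sums_unique[OF sums_single, symmetric])
  qed
  have "(\<integral>\<^sup>+x. g x \<partial>lborel) = (\<integral>\<^sup>+x. (\<Sum>i. g x * indicator D (x + l i)) \<partial>lborel)"
    by (simp add: one)
  also have "\<dots> = (\<Sum>i. \<integral>\<^sup>+x. g x * indicator D (x + l i) \<partial>lborel)"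
    by (rule nn_integral_suminf) measurable
  also have "\<dots> = (\<Sum>i. \<integral>\<^sup>+x. g (x - l i) * indicator D x \<partial>lborel)"
  proof (intro suminf_cong)
    fix i
    have "(\<integral>\<^sup>+x. g ((x + l i) - l i) * indicator D (x + l i) \<partial>lborel)
        = (\<integral>\<^sup>+x. g (x - l i) * indicator D x \<partial>lborel)"
      by (rule nn_integral_lborel_translate) measurable
    then show "(\<integral>\<^sup>+x. g x * indicator D (x + l i) \<partial>lborel) = (\<integral>\<^sup>+x. g (x - l i) * indicator D x \<partial>lborel)"
      by simp
  qed
  also have "\<dots> = (\<integral>\<^sup>+x. (\<Sum>i. g (x - l i) * indicator D x) \<partial>lborel)"
    by (rule nn_integral_suminf[symmetric]) measurable
  finally show ?thesis by simp
qed

lemma fund_domain_unique_index: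
  fixes R :: "real^'n^'n"
  assumes R: "invertible R" and l: "bij_betw l UNIV (lattice R)"
  shows "\<exists>!i. x + l i \<in> fund_domain R"
proof -
  obtain m where m: "m \<in> lattice R" "x + m \<in> fund_domain R"
    and uniq: "\<And>m'. m' \<in> lattice R \<Longrightarrow> x + m' \<in> fund_domain R \<Longrightarrow> m' = m"
    using fund_domain_unique[OF R, of x] by (elim ex1E) blast
  obtain i where i: "l i = m" using m(1) l by (metis bij_betw_imp_surj_on image_iff)
  have "j = i" if "x + l j \<in> fund_domain R" for j
    using uniq[of "l j"] that i l by (metis UNIV_I bij_betw_apply bij_betw_imp_inj_on injD)
  with m(2) i show ?thesis by blast
qed

context
  fixes D :: "'a::euclidean_space set" and l :: "nat \<Rightarrow> 'a" and g :: "'a \<Rightarrow> ennreal" and E :: "'a set"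
  assumes D [measurable]: "D \<in> sets borel" and unique: "\<And>x. \<exists>!i. x + l i \<in> D"
    and g [measurable]: "g \<in> borel_measurable borel"
begin

lemma nn_integral_periodization:
  "(\<integral>\<^sup>+x. (\<Sum>i. \<Sum>e\<in>E. g (x - l i - e)) * indicator D x \<partial>lborel)
    = of_nat (card E) * (\<integral>\<^sup>+x. g x \<partial>lborel)"
proof -
  have "(\<integral>\<^sup>+x. (\<Sum>i. \<Sum>e\<in>E. g (x - l i - e)) * indicator D x \<partial>lborel)
      = (\<integral>\<^sup>+x. (\<Sum>e\<in>E. g (x - e)) \<partial>lborel)"
    by (rule nn_integral_unfold[symmetric, where g="\<lambda>x. \<Sum>e\<in>E. g (x - e)", OF _ D unique]) measurable
  also have "\<dots> = (\<Sum>e\<in>E. \<integral>\<^sup>+x. g (x - e) \<partial>lborel)"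
    by (rule nn_integral_sum) measurable
  also have "\<dots> = (\<Sum>e\<in>E. \<integral>\<^sup>+x. g x \<partial>lborel)"
    using nn_integral_lborel_translate[OF g, of "- _"] by simp
  finally show ?thesis by simp
qed

text \<open>The bound \<open>c\<close> is kept general: it is 1 for packings by cubes, and
  \<open>card E\<close> when points of a dual lattice coset are counted.\<close>

lemma packing_card_le:
  assumes int_g: "(\<integral>\<^sup>+x. g x \<partial>lborel) = 1"
    and le: "\<And>x. (\<Sum>i. \<Sum>e\<in>E. g (x - l i - e)) \<le> c"
  shows "of_nat (card E) \<le> c * emeasure lborel D"
proof -
  have "of_nat (card E) = (\<integral>\<^sup>+x. (\<Sum>i. \<Sum>e\<in>E. g (x - l i - e)) * indicator D x \<partial>lborel)"
    using nn_integral_periodization int_g by simp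
  also have "\<dots> \<le> (\<integral>\<^sup>+x. c * indicator D x \<partial>lborel)"
    by (intro nn_integral_mono mult_right_mono le) simp
  finally show ?thesis by (simp add: nn_integral_cmult)
qed

text \<open>On \<open>D\<close> the deficit of the sum below 1 is nonnegative and has integral
  0.\<close>

lemma packing_imp_tiling_AE_on:
  assumes int_g: "(\<integral>\<^sup>+x. g x \<partial>lborel) = 1"
    and le_1: "\<And>x. (\<Sum>i. \<Sum>e\<in>E. g (x - l i - e)) \<le> 1"
    and card: "of_nat (card E) = emeasure lborel D"
  shows "AE x in lborel. x \<in> D \<longrightarrow> (\<Sum>i. \<Sum>e\<in>E. g (x - l i - e)) = 1"
proof -
  let ?S = "\<lambda>x. \<Sum>i. \<Sum>e\<in>E. g (x - l i - e)"
  have S: "(\<integral>\<^sup>+x. ?S x * indicator D x \<partial>lborel) = emeasure lborel D"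
    using nn_integral_periodization int_g card by simp
  \<comment> \<open>Integrals of extended nonnegative functions may only be subtracted when finite;
    here the volume of \<open>D\<close> equals a natural number.\<close>
  have fin: "emeasure lborel D \<noteq> \<infinity>"
    using card[symmetric] by (simp add: ennreal_of_nat_eq_real_of_nat)
  have "(\<integral>\<^sup>+x. indicator D x - ?S x * indicator D x \<partial>lborel)
      = (\<integral>\<^sup>+x. indicator D x \<partial>lborel) - (\<integral>\<^sup>+x. ?S x * indicator D x \<partial>lborel)"
  proof (rule nn_integral_diff)
    show "AE x in lborel. ?S x * indicator D x \<le> indicator D x"
      using le_1 by (intro AE_I2) (simp add: indicator_def)
  qed (use S fin in simp_all)
  also have "\<dots> = 0"
    using fin by (simp add: S)
  finally have "AE x in lborel. indicator D x - ?S x * indicator D x = 0"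
    by (subst (asm) nn_integral_0_iff_AE) auto
  then show ?thesis
  proof eventually_elim
    case (elim x)
    then show ?case
      using le_1[of x] by (auto simp: diff_eq_0_iff_ennreal intro!: antisym)
  qed
qed

end

text \<open>Each set \<open>{x. x + l j \<in> D}\<close> has the volume of \<open>D\<close> and the
  same unique-representative property, so the previous result applies to it. These countably many
  sets cover the space.\<close>

lemma packing_imp_tiling_AE:
  fixes D :: "'a::euclidean_space set" and l :: "nat \<Rightarrow> 'a" and g :: "'a \<Rightarrow> ennreal"
  assumes D [measurable]: "D \<in> sets borel" and unique: "\<And>x. \<exists>!i. x + l i \<in> D"
    and g [measurable]: "g \<in> borel_measurable borel" and int_g: "(\<integral>\<^sup>+x. g x \<partial>lborel) = 1"
    and le_1: "\<And>x. (\<Sum>i. \<Sum>e\<in>E. g (x - l i - e)) \<le> 1"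
    and card: "of_nat (card E) = emeasure lborel D"
  shows "AE x in lborel. (\<Sum>i. \<Sum>e\<in>E. g (x - l i - e)) = 1"
proof -
  have "AE x in lborel. x + l j \<in> D \<longrightarrow> (\<Sum>i. \<Sum>e\<in>E. g (x - l i - e)) = 1" for j
  proof -
    define D' where "D' = (\<lambda>x. x + l j) -` D \<inter> space borel"
    have D' [measurable]: "D' \<in> sets borel"
      unfolding D'_def by (rule measurable_sets[OF _ D]) measurable
    have "\<exists>!i. x + l i \<in> D'" for x
      using unique[of "x + l j"] by (simp add: D'_def add_ac)
    moreover have "of_nat (card E) = emeasure lborel D'"
    proof -
      have "emeasure lborel D' = (\<integral>\<^sup>+x. indicator D (x + l j) \<partial>lborel)"
      proof -
        have "indicator D (x + l j) = (indicator D' x :: ennreal)" for x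
          by (simp add: D'_def indicator_def)
        then show ?thesis by simp
      qed
      also have "\<dots> = emeasure lborel D"
        by (subst nn_integral_lborel_translate) auto
      finally show ?thesis using card by simp
    qed
    ultimately have "AE x in lborel. x \<in> D' \<longrightarrow> (\<Sum>i. \<Sum>e\<in>E. g (x - l i - e)) = 1"
      by (intro packing_imp_tiling_AE_on D' g int_g le_1)
    then show ?thesis by (simp add: D'_def)
  qed
  then have "AE x in lborel. \<forall>j. x + l j \<in> D \<longrightarrow> (\<Sum>i. \<Sum>e\<in>E. g (x - l i - e)) = 1"
    unfolding AE_all_countable by blast
  then show ?thesis
    by eventually_elim (use unique in blast)
qed

section \<open>Bessel's inequality on the unit cube\<close>


abbreviation cubeM :: "(real^'n) measure" where
  "cubeM \<equiv> restrict_space lebesgue unit_cube"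

lemma unit_cube_lebesgue: "unit_cube \<in> sets lebesgue"
  using unit_cube_borel by (simp add: sets_completionI_sets)

lemma space_cubeM: "space cubeM = unit_cube"
  by (simp add: space_restrict_space)

lemma finite_measure_cubeM: "finite_measure (cubeM :: (real^'n) measure)"
proof
  have "emeasure (cubeM :: (real^'n) measure) unit_cube = 1"
    using unit_cube_lebesgue unit_cube_borel[where 'n='n]
    by (simp add: emeasure_restrict_space emeasure_unit_cube)
  then show "emeasure (cubeM :: (real^'n) measure) (space cubeM) \<noteq> \<infinity>"
    by (simp add: space_cubeM)
qed

lemma measurable_cubeM:
  "f \<in> borel_measurable borel \<Longrightarrow> f \<in> borel_measurable cubeM"
  by (intro measurable_restrict_space1 measurable_completion) simp

lemma L2_inner_cubeM: "L2_inner unit_cube f g = (\<integral>x. f x * cnj (g x) \<partial>cubeM)"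
  unfolding L2_inner_def set_lebesgue_integral_def
  by (rule integral_restrict_space[symmetric]) (simp add: unit_cube_lebesgue)

lemma in_L2_cubeM:
  "in_L2 unit_cube f \<longleftrightarrow> f \<in> borel_measurable cubeM \<and> integrable cubeM (\<lambda>x. (cmod (f x))\<^sup>2)"
  unfolding in_L2_def set_borel_measurable_def set_integrable_def
  by (simp add: borel_measurable_restrict_space_iff integrable_restrict_space unit_cube_lebesgue)

lemma borel_measurable_expo [measurable]: "expo z \<in> borel_measurable borel"
  unfolding expo_def[abs_def] by measurable

lemma borel_measurable_cnj [measurable (raw)]:
  "f \<in> borel_measurable M \<Longrightarrow> (\<lambda>x. cnj (f x)) \<in> borel_measurable M"
  by (rule measurable_compose[OF _ borel_measurable_continuous_onI]) (auto intro: continuous_intros)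

declare measurable_cubeM[OF borel_measurable_expo, measurable]

lemma cmod_expo [simp]: "cmod (expo z x) = 1"
  by (simp add: expo_def)

lemma expo_add: "expo (a + b) x = expo a x * expo b x"
  by (simp add: expo_def inner_add_left distrib_left exp_add[symmetric])

lemma expo_add_right: "expo a (x + y) = expo a x * expo a y"
  by (simp add: expo_def inner_add_right distrib_left exp_add[symmetric])

lemma expo_0 [simp]: "expo 0 x = 1"
  by (simp add: expo_def)

lemma cnj_expo: "cnj (expo a x) = expo (- a) x"
  by (simp add: expo_def exp_cnj)

lemma cnj_expo_times [simp]: "expo a x * cnj (expo a x) = 1"
  unfolding cnj_expo expo_add[symmetric] by simp

lemma integrable_cubeM_bounded:
  fixes f :: "real^'n \<Rightarrow> complex"
  assumes "f \<in> borel_measurable cubeM" "\<And>x. cmod (f x) \<le> B"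
  shows "integrable cubeM f"
  using finite_measure.integrable_const_bound[OF finite_measure_cubeM _ assms(1)] assms(2) by blast

lemma L2_inner_expo:
  "L2_inner unit_cube (expo l) (expo m) = cube_FT (l - m)"
proof -
  have "L2_inner unit_cube (expo l) (expo m) = (\<integral>x. indicator unit_cube x * expo (l - m) x \<partial>lebesgue)"
    unfolding L2_inner_def set_lebesgue_integral_def cnj_expo expo_add[symmetric]
    by (intro Bochner_Integration.integral_cong) (auto simp: indicator_def)
  also have "\<dots> = cube_FT (l - m)"
    unfolding cube_FT_def by (rule integral_completion) measurable
  finally show ?thesis .
qed

lemma cube_FT_0: "cube_FT (0 :: real^'n) = 1"
proof -
  have "cube_FT (0 :: real^'n) = (\<integral>x. complex_of_real (indicator unit_cube x) \<partial>(lborel :: (real^'n) measure))"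
    unfolding cube_FT_def by (intro Bochner_Integration.integral_cong) (auto simp: indicator_def)
  also have "\<dots> = 1"
    by (subst integral_complex_of_real) (simp add: measure_def emeasure_unit_cube)
  finally show ?thesis .
qed

lemma cnj_cube_FT: "cnj (cube_FT z) = cube_FT (- z)"
  unfolding cube_FT_def
  by (subst Bochner_Integration.integral_cnj[symmetric], intro Bochner_Integration.integral_cong) (auto simp: cnj_expo indicator_def)

lemma cubeM_expo: "(\<integral>x. expo a x * cnj (expo b x) \<partial>cubeM) = cube_FT (a - b)"
  using L2_inner_expo unfolding L2_inner_cubeM .

section \<open>Bessel remainders\<close>

text \<open>The coefficient \<open>cube_FT (x - a)\<close> is the inner product of
  \<open>expo x\<close> with \<open>expo a\<close>. For an orthonormal family this is therefore what
  remains of \<open>expo x\<close> after projection to the span of the \<open>expo a\<close> with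
  \<open>a \<in> A\<close>.\<close>

definition bessel_rem :: "(real^'n) set \<Rightarrow> real^'n \<Rightarrow> real^'n \<Rightarrow> complex" where
  "bessel_rem A x y = expo x y - (\<Sum>a\<in>A. cube_FT (x - a) * expo a y)"

lemma borel_measurable_bessel_rem [measurable]: "bessel_rem A x \<in> borel_measurable borel"
  unfolding bessel_rem_def[abs_def] by measurable

declare measurable_cubeM[OF borel_measurable_bessel_rem, measurable]

lemma cmod_bessel_rem_le: "cmod (bessel_rem A x y) \<le> 1 + (\<Sum>a\<in>A. cmod (cube_FT (x - a)))"
proof -
  have "cmod (bessel_rem A x y) \<le> cmod (expo x y) + cmod (\<Sum>a\<in>A. cube_FT (x - a) * expo a y)"
    unfolding bessel_rem_def by (rule norm_triangle_ineq4)
  also have "\<dots> \<le> 1 + (\<Sum>a\<in>A. cmod (cube_FT (x - a)))"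
    using norm_sum[of "\<lambda>a. cube_FT (x - a) * expo a y" A] by (simp add: norm_mult)
  finally show ?thesis .
qed

lemma integrable_expo_mult: "integrable cubeM (\<lambda>y. expo a y * cnj (expo b y))"
  by (rule integrable_cubeM_bounded[where B=1]) (auto simp: norm_mult)

lemma inner_bessel_rem_expo:
  assumes "finite A"
  shows "(\<integral>y. bessel_rem A x y * cnj (expo b y) \<partial>cubeM)
    = cube_FT (x - b) - (\<Sum>a\<in>A. cube_FT (x - a) * cube_FT (a - b))"
proof -
  have "(\<integral>y. bessel_rem A x y * cnj (expo b y) \<partial>cubeM)
    = (\<integral>y. expo x y * cnj (expo b y) - (\<Sum>a\<in>A. cube_FT (x - a) * (expo a y * cnj (expo b y))) \<partial>cubeM)"
    by (simp add: bessel_rem_def left_diff_distrib sum_distrib_right mult.assoc)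
  also have "\<dots> = (\<integral>y. expo x y * cnj (expo b y) \<partial>cubeM)
      - (\<Sum>a\<in>A. \<integral>y. cube_FT (x - a) * (expo a y * cnj (expo b y)) \<partial>cubeM)"
    by (subst Bochner_Integration.integral_diff)
      (auto intro!: integrable_expo_mult Bochner_Integration.integrable_sum integrable_mult_right
        simp: Bochner_Integration.integral_sum integrable_expo_mult)
  finally show ?thesis
    by (simp add: cubeM_expo)
qed

text \<open>Pythagoras: the remainder is orthogonal to the span, so its squared norm is its inner
  product with \<open>expo x\<close>.\<close>

lemma norm_bessel_rem:
  assumes A: "finite A" and orth: "\<And>a b. a \<in> A \<Longrightarrow> b \<in> A \<Longrightarrow> a \<noteq> b \<Longrightarrow> cube_FT (a - b) = 0"
  shows "(\<integral>y. (cmod (bessel_rem A x y))\<^sup>2 \<partial>cubeM) = 1 - (\<Sum>a\<in>A. (cmod (cube_FT (x - a)))\<^sup>2)"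
proof -
  let ?h = "bessel_rem A x" and ?c = "\<lambda>a. cube_FT (x - a)"
  have int: "integrable cubeM (\<lambda>y. ?h y * cnj (expo b y))" for b
    by (rule integrable_cubeM_bounded[OF _ order_trans[OF _ cmod_bessel_rem_le]]) (auto simp: norm_mult)
  have h_orth: "(\<integral>y. ?h y * cnj (expo b y) \<partial>cubeM) = 0" if b: "b \<in> A" for b
  proof -
    have "(\<Sum>a\<in>A. ?c a * cube_FT (a - b)) = (\<Sum>a\<in>A. if a = b then ?c b else 0)"
      using orth b by (intro sum.cong) (auto simp: cube_FT_0)
    then show ?thesis
      using A b by (simp add: inner_bessel_rem_expo)
  qed
  have "complex_of_real (\<integral>y. (cmod (?h y))\<^sup>2 \<partial>cubeM) = (\<integral>y. ?h y * cnj (?h y) \<partial>cubeM)"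
    by (simp add: complex_norm_square[symmetric] flip: integral_complex_of_real)
  \<comment> \<open>Only the conjugated factor is expanded, so that the terms over \<open>A\<close>
    vanish by \<open>h_orth\<close>.\<close>
  also have "\<dots> = (\<integral>y. ?h y * cnj (expo x y) - (\<Sum>a\<in>A. cnj (?c a) * (?h y * cnj (expo a y))) \<partial>cubeM)"
    by (subst (2) bessel_rem_def) (simp add: right_diff_distrib sum_distrib_left mult_ac)
  also have "\<dots> = (\<integral>y. ?h y * cnj (expo x y) \<partial>cubeM)
      - (\<Sum>a\<in>A. \<integral>y. cnj (?c a) * (?h y * cnj (expo a y)) \<partial>cubeM)"
    by (subst Bochner_Integration.integral_diff)
      (auto intro!: int Bochner_Integration.integrable_sum integrable_mult_right
        simp: Bochner_Integration.integral_sum int)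
  also have "\<dots> = 1 - (\<Sum>a\<in>A. ?c a * cube_FT (a - x))"
    using h_orth by (simp add: inner_bessel_rem_expo[OF A] cube_FT_0)
  also have "\<dots> = complex_of_real (1 - (\<Sum>a\<in>A. (cmod (?c a))\<^sup>2))"
    by (simp only: of_real_diff of_real_1 of_real_sum complex_norm_square cnj_cube_FT minus_diff_eq)
  finally show ?thesis
    by (simp only: of_real_eq_iff)
qed

lemma bessel_inequality:
  assumes "finite A" "\<And>a b. a \<in> A \<Longrightarrow> b \<in> A \<Longrightarrow> a \<noteq> b \<Longrightarrow> cube_FT (a - b) = 0"
  shows "(\<Sum>a\<in>A. (cmod (cube_FT (x - a)))\<^sup>2) \<le> 1"
proof -
  have "0 \<le> (\<integral>y. (cmod (bessel_rem A x y))\<^sup>2 \<partial>cubeM)"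
    by (rule Bochner_Integration.integral_nonneg) simp
  then show ?thesis
    using norm_bessel_rem[OF assms, of x] by simp
qed

text \<open>On a space of finite measure square integrability implies integrability, by
  \<open>cmod (f x) \<le> 1 + (cmod (f x))\<^sup>2\<close>.\<close>

lemma in_L2_imp_integrable:
  assumes f: "in_L2 unit_cube f" and g: "g \<in> borel_measurable cubeM" "\<And>x. cmod (g x) \<le> B"
  shows "integrable cubeM (\<lambda>x. f x * g x)"
proof (rule Bochner_Integration.integrable_bound)
  have "integrable cubeM (\<lambda>x. (1::real))"
    using finite_measure.integrable_const finite_measure_cubeM by blast
  then show "integrable cubeM (\<lambda>x. B * (1 + (cmod (f x))\<^sup>2))"
    using f unfolding in_L2_cubeM by (intro integrable_mult_right Bochner_Integration.integrable_add) auto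
  show "(\<lambda>x. f x * g x) \<in> borel_measurable cubeM"
    using f g(1) unfolding in_L2_cubeM by (intro borel_measurable_times) auto
  have "norm (f x * g x) \<le> norm (B * (1 + (cmod (f x))\<^sup>2))" for x
  proof -
    have "2 * cmod (f x) \<le> 1 + (cmod (f x))\<^sup>2"
      using zero_le_power2[of "cmod (f x) - 1"] by (simp add: power2_diff)
    then have "cmod (f x) \<le> 1 + (cmod (f x))\<^sup>2"
      using norm_ge_zero[of "f x"] by linarith
    moreover have "0 \<le> B" using g(2)[of x] norm_ge_zero order_trans by blast
    ultimately have "cmod (f x) * cmod (g x) \<le> (1 + (cmod (f x))\<^sup>2) * B"
      using g(2) by (intro mult_mono) auto
    then show ?thesis using \<open>0 \<le> B\<close> by (simp add: norm_mult abs_mult mult.commute)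
  qed
  then show "AE x in cubeM. norm (f x * g x) \<le> norm (B * (1 + (cmod (f x))\<^sup>2))" by simp
qed

text \<open>As \<open>f\<close> is orthogonal to the span, \<open>expo x\<close> may be replaced by
  its remainder. The weighted inequality
  \<open>2 * u * v \<le> t * u\<^sup>2 + v\<^sup>2 / t\<close> then stands in for Cauchy-Schwarz;
  the weight \<open>t\<close> is sent to 0 after the remainder has been made small.\<close>

lemma inner_le_bessel_rem:
  assumes A: "finite A" and orth: "\<And>a b. a \<in> A \<Longrightarrow> b \<in> A \<Longrightarrow> a \<noteq> b \<Longrightarrow> cube_FT (a - b) = 0"
    and f: "in_L2 unit_cube f" and f_orth: "\<And>a. a \<in> A \<Longrightarrow> L2_inner unit_cube f (expo a) = 0"
    and t: "t > 0"
  shows "2 * cmod (L2_inner unit_cube f (expo x))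
    \<le> t * (\<integral>y. (cmod (f y))\<^sup>2 \<partial>cubeM) + (1 - (\<Sum>a\<in>A. (cmod (cube_FT (x - a)))\<^sup>2)) / t"
proof -
  let ?h = "bessel_rem A x"
  have int: "integrable cubeM (\<lambda>y. f y * cnj (expo b y))" for b
    by (rule in_L2_imp_integrable[OF f, where B=1]) auto
  have int_fh: "integrable cubeM (\<lambda>y. f y * cnj (?h y))"
    by (rule in_L2_imp_integrable[OF f _ order_trans[OF _ cmod_bessel_rem_le]]) auto
  have int_h: "integrable cubeM (\<lambda>y. (cmod (?h y))\<^sup>2)"
    by (rule finite_measure.integrable_const_bound[OF finite_measure_cubeM,
          where B="(1 + (\<Sum>a\<in>A. cmod (cube_FT (x - a))))\<^sup>2"])
      (auto intro!: power_mono cmod_bessel_rem_le)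
  have "(\<integral>y. f y * cnj (?h y) \<partial>cubeM)
      = (\<integral>y. f y * cnj (expo x y) - (\<Sum>a\<in>A. cnj (cube_FT (x - a)) * (f y * cnj (expo a y))) \<partial>cubeM)"
    by (simp add: bessel_rem_def right_diff_distrib sum_distrib_left mult_ac)
  also have "\<dots> = (\<integral>y. f y * cnj (expo x y) \<partial>cubeM)
      - (\<Sum>a\<in>A. \<integral>y. cnj (cube_FT (x - a)) * (f y * cnj (expo a y)) \<partial>cubeM)"
    by (subst Bochner_Integration.integral_diff)
      (auto intro!: int Bochner_Integration.integrable_sum integrable_mult_right
        simp: Bochner_Integration.integral_sum int)
  also have "\<dots> = L2_inner unit_cube f (expo x)"
    using f_orth by (simp add: L2_inner_cubeM)
  finally have "2 * cmod (L2_inner unit_cube f (expo x)) = 2 * cmod (\<integral>y. f y * cnj (?h y) \<partial>cubeM)"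
    by simp
  also have "\<dots> \<le> 2 * (\<integral>y. cmod (f y * cnj (?h y)) \<partial>cubeM)"
    using integral_norm_bound[of cubeM "\<lambda>y. f y * cnj (?h y)"] by simp
  also have "\<dots> = (\<integral>y. 2 * cmod (f y * cnj (?h y)) \<partial>cubeM)"
    by simp
  also have "\<dots> \<le> (\<integral>y. t * (cmod (f y))\<^sup>2 + (cmod (?h y))\<^sup>2 / t \<partial>cubeM)"
  proof (rule integral_mono)
    show "integrable cubeM (\<lambda>y. t * (cmod (f y))\<^sup>2 + (cmod (?h y))\<^sup>2 / t)"
      using f int_h by (simp add: in_L2_cubeM)
    show "integrable cubeM (\<lambda>y. 2 * cmod (f y * cnj (?h y)))"
      using int_fh by simp
    fix y
    have "0 \<le> (t * cmod (f y) - cmod (?h y))\<^sup>2 / t"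
      using t by simp
    also have "\<dots> = t * (cmod (f y))\<^sup>2 + (cmod (?h y))\<^sup>2 / t - 2 * cmod (f y * cnj (?h y))"
      using t by (simp add: power2_eq_square field_simps norm_mult)
    finally show "2 * cmod (f y * cnj (?h y)) \<le> t * (cmod (f y))\<^sup>2 + (cmod (?h y))\<^sup>2 / t"
      by simp
  qed
  also have "\<dots> = t * (\<integral>y. (cmod (f y))\<^sup>2 \<partial>cubeM) + (\<integral>y. (cmod (?h y))\<^sup>2 \<partial>cubeM) / t"
    using f int_h by (simp add: in_L2_cubeM)
  also note norm_bessel_rem[OF A orth]
  finally show ?thesis by simp
qed

section \<open>Completeness of the exponentials\<close>


text \<open>Frequencies are arbitrary vectors, not only integer ones. So the exponentials separate
  all points of the closed cube, opposite faces included, and Stone-Weierstrass applies without any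
  periodicity.\<close>

inductive trig_poly :: "(real^'n \<Rightarrow> complex) \<Rightarrow> bool" where
  trig_monom: "trig_poly (\<lambda>x. c * expo a x)"
| trig_add: "trig_poly p \<Longrightarrow> trig_poly q \<Longrightarrow> trig_poly (\<lambda>x. p x + q x)"

lemma trig_poly_mult:
  assumes "trig_poly p" "trig_poly q"
  shows "trig_poly (\<lambda>x. p x * q x)"
  using assms(1)
proof induction
  case (trig_monom c a)
  show ?case
    using assms(2)
  proof induction
    case (trig_monom d b)
    have "(\<lambda>x. c * expo a x * (d * expo b x)) = (\<lambda>x. c * d * expo (a + b) x)"
      by (simp add: expo_add mult_ac)
    then show ?case by (simp only: trig_poly.trig_monom)
  next
    case (trig_add p q)
    then show ?case by (simp only: distrib_left trig_poly.trig_add)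
  qed
next
  case (trig_add p q)
  then show ?case by (simp only: distrib_right trig_poly.trig_add)
qed

lemma continuous_on_expo [continuous_intros]: "continuous_on S (expo a)"
  unfolding expo_def[abs_def] by (intro continuous_intros)

lemma trig_poly_continuous: "trig_poly p \<Longrightarrow> continuous_on S p"
  by (induction rule: trig_poly.induct) (auto intro!: continuous_intros)

lemma trig_poly_bounded: "trig_poly p \<Longrightarrow> \<exists>B. \<forall>x. cmod (p x) \<le> B"
proof (induction rule: trig_poly.induct)
  case (trig_monom c a)
  show ?case by (intro exI[of _ "cmod c"]) (simp add: norm_mult)
next
  case (trig_add p q)
  then obtain B C where "\<forall>x. cmod (p x) \<le> B" "\<forall>x. cmod (q x) \<le> C" by blast
  then show ?case by (intro exI[of _ "B + C"]) (blast intro: norm_triangle_mono)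
qed

lemma in_L2_integrable_mult_trig_poly:
  assumes "in_L2 unit_cube f" "trig_poly p"
  shows "integrable cubeM (\<lambda>x. f x * p x)"
proof -
  obtain B where "\<forall>x. cmod (p x) \<le> B" using trig_poly_bounded[OF assms(2)] by blast
  then show ?thesis
    using assms by (intro in_L2_imp_integrable[where B=B] measurable_cubeM
        borel_measurable_continuous_onI trig_poly_continuous) auto
qed

lemma trig_poly_orthogonal:
  assumes f: "in_L2 unit_cube f" and orth: "\<And>a. L2_inner unit_cube f (expo a) = 0"
    and "trig_poly p"
  shows "(\<integral>x. f x * p x \<partial>cubeM) = 0"
  using assms(3)
proof induction
  case (trig_monom c a)
  have "(\<integral>x. f x * (c * expo a x) \<partial>cubeM) = (\<integral>x. c * (f x * cnj (expo (- a) x)) \<partial>cubeM)"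
    by (simp add: cnj_expo mult_ac)
  also have "\<dots> = 0"
    using orth[of "- a"] by (simp add: L2_inner_cubeM)
  finally show ?case .
next
  case (trig_add p q)
  have "(\<integral>x. f x * p x + f x * q x \<partial>cubeM) = (\<integral>x. f x * p x \<partial>cubeM) + (\<integral>x. f x * q x \<partial>cubeM)"
    by (intro Bochner_Integration.integral_add in_L2_integrable_mult_trig_poly f trig_add.hyps)
  then show ?case by (simp add: distrib_left trig_add.IH)
qed

lemma trig_poly_sin: "trig_poly (\<lambda>x. complex_of_real (sin (2 * pi * (a \<bullet> x))))"
proof -
  have "trig_poly (\<lambda>x. (1 / (2 * \<i>)) * expo a x + (- 1 / (2 * \<i>)) * expo (- a) x)"
    by (intro trig_poly.intros)
  moreover have "(1 / (2 * \<i>)) * expo a x + (- 1 / (2 * \<i>)) * expo (- a) x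
      = complex_of_real (sin (2 * pi * (a \<bullet> x)))" for x
    unfolding expo_def sin_of_real[symmetric] sin_exp_eq by (simp add: field_simps)
  ultimately show ?thesis by simp
qed

lemma trig_poly_dense:
  fixes g :: "real^'n \<Rightarrow> real"
  assumes "continuous_on UNIV g" "0 < e"
  shows "\<exists>p. trig_poly (\<lambda>x. complex_of_real (p x)) \<and> (\<forall>x\<in>cbox 0 1. \<bar>g x - p x\<bar> < e)"
proof (rule Stone_Weierstrass_HOL[of "cbox 0 (1::real^'n)"
      "\<lambda>p. trig_poly (\<lambda>x. complex_of_real (p x))" g e])
  show "trig_poly (\<lambda>x::real^'n. complex_of_real c)" for c
    using trig_poly.trig_monom[of "complex_of_real c" "0::real^'n"] by simp
  show "continuous_on (cbox 0 1) p" if "trig_poly (\<lambda>x. complex_of_real (p x))" for p :: "real^'n \<Rightarrow> real"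
    using continuous_on_Re[OF trig_poly_continuous[OF that]] by simp
  show "trig_poly (\<lambda>x. complex_of_real (p x + q x))"
    if "trig_poly (\<lambda>x. complex_of_real (p x)) \<and> trig_poly (\<lambda>x. complex_of_real (q x))"
    for p q :: "real^'n \<Rightarrow> real"
    using that by (auto intro: trig_poly.trig_add)
  show "trig_poly (\<lambda>x. complex_of_real (p x * q x))"
    if "trig_poly (\<lambda>x. complex_of_real (p x)) \<and> trig_poly (\<lambda>x. complex_of_real (q x))"
    for p q :: "real^'n \<Rightarrow> real"
    using that by (auto intro: trig_poly_mult)
  fix x y :: "real^'n"
  assume xy: "x \<in> cbox 0 1 \<and> y \<in> cbox 0 1 \<and> x \<noteq> y"
  then obtain i where i: "x $ i \<noteq> y $ i" by (auto simp: vec_eq_iff)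
  \<comment> \<open>The frequency 1/4 makes the argument \<open>pi * z $ i / 2\<close>, which stays
    in a range where the sine is injective.\<close>
  have "2 * pi * (axis i (1/4) \<bullet> z) \<in> {-(pi/2)..pi/2}" if "z \<in> cbox 0 1" for z :: "real^'n"
  proof -
    have z: "0 \<le> z $ i" "z $ i \<le> 1" using that by (auto simp: mem_box_cart)
    then have "pi * z $ i \<le> pi" "0 \<le> pi * z $ i" by simp_all
    then have "- (pi/2) \<le> pi * z $ i / 2" "pi * z $ i / 2 \<le> pi / 2"
      using pi_gt_zero by linarith+
    then show ?thesis by (simp add: inner_axis')
  qed
  then have "sin (2 * pi * (axis i (1/4) \<bullet> x)) \<noteq> sin (2 * pi * (axis i (1/4) \<bullet> y))"
    using xy i sin_inj_pi[of "2 * pi * (axis i (1/4) \<bullet> x)" "2 * pi * (axis i (1/4) \<bullet> y)"]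
    by (auto simp: inner_axis')
  then show "\<exists>p. trig_poly (\<lambda>x. complex_of_real (p x)) \<and> p x \<noteq> p y"
    using trig_poly_sin by (intro exI[where x="\<lambda>x. sin (2 * pi * (axis i (1/4) \<bullet> x))"]) simp
qed (use assms continuous_on_subset in auto)

section \<open>From vanishing coefficients to a vanishing function\<close>

text \<open>Replacing \<open>g\<close> by a trigonometric polynomial that is within \<open>e\<close>
  of it on the cube makes the integral 0 and changes it by at most \<open>e\<close> times the
  integral of \<open>cmod (f x)\<close>.\<close>

lemma continuous_orthogonal:
  fixes g :: "real^'n \<Rightarrow> real"
  assumes f: "in_L2 unit_cube f" and orth: "\<And>a. L2_inner unit_cube f (expo a) = 0"
    and g: "continuous_on UNIV g" and B: "\<And>x. \<bar>g x\<bar> \<le> B"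
  shows "(\<integral>x. f x * complex_of_real (g x) \<partial>cubeM) = 0"
proof (rule ccontr)
  let ?I = "\<integral>x. f x * complex_of_real (g x) \<partial>cubeM" and ?N = "\<integral>x. cmod (f x) \<partial>cubeM"
  assume "?I \<noteq> 0"
  have int_f: "integrable cubeM (\<lambda>x. cmod (f x))"
    using in_L2_imp_integrable[OF f, of "\<lambda>_. 1" 1] by simp
  have N: "0 \<le> ?N" by simp
  \<comment> \<open>Chosen so that \<open>e * ?N < cmod ?I\<close>; the added 1 keeps the
    denominator positive when \<open>?N = 0\<close>.\<close>
  define e where "e = cmod ?I / (2 * (?N + 1))"
  have e: "0 < e" unfolding e_def using N \<open>?I \<noteq> 0\<close>
    by (intro divide_pos_pos mult_pos_pos add_nonneg_pos) (simp_all only: zero_less_norm_iff zero_less_numeral zero_less_one not_False_eq_True)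
  obtain p where p: "trig_poly (\<lambda>x. complex_of_real (p x))" "\<forall>x\<in>cbox 0 1. \<bar>g x - p x\<bar> < e"
    using trig_poly_dense[OF g e] by blast
  have int_g: "integrable cubeM (\<lambda>x. f x * complex_of_real (g x))"
    by (rule in_L2_imp_integrable[OF f, where B=B])
      (auto intro!: measurable_cubeM borel_measurable_continuous_onI continuous_intros g B)
  note int_p = in_L2_integrable_mult_trig_poly[OF f p(1)]
  have "?I = (\<integral>x. f x * complex_of_real (g x) - f x * complex_of_real (p x) \<partial>cubeM)"
    unfolding Bochner_Integration.integral_diff[OF int_g int_p] trig_poly_orthogonal[OF f orth p(1)]
    by (rule diff_0_right[symmetric])
  then have "cmod ?I \<le> (\<integral>x. cmod (f x * complex_of_real (g x) - f x * complex_of_real (p x)) \<partial>cubeM)"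
    using integral_norm_bound[of cubeM "\<lambda>x. f x * complex_of_real (g x) - f x * complex_of_real (p x)"]
    by (simp only:)
  also have "\<dots> \<le> (\<integral>x. e * cmod (f x) \<partial>cubeM)"
  proof (rule integral_mono)
    show "integrable cubeM (\<lambda>x. cmod (f x * complex_of_real (g x) - f x * complex_of_real (p x)))"
      using int_g int_p by simp
    show "integrable cubeM (\<lambda>x. e * cmod (f x))"
      using int_f by simp
    fix x :: "real^'n"
    assume "x \<in> space cubeM"
    then have "x \<in> cbox 0 1"
      unfolding space_cubeM by (auto simp: unit_cube_def mem_box_cart less_imp_le)
    then have "\<bar>g x - p x\<bar> \<le> e" using p(2) by (simp add: less_imp_le)
    then have "cmod (f x) * \<bar>g x - p x\<bar> \<le> cmod (f x) * e"
      by (rule mult_left_mono) simp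
    then show "cmod (f x * complex_of_real (g x) - f x * complex_of_real (p x)) \<le> e * cmod (f x)"
      by (simp only: right_diff_distrib[symmetric] norm_mult of_real_diff[symmetric] norm_of_real mult.commute)
  qed
  also have "\<dots> = cmod ?I * (?N / (2 * (?N + 1)))"
    by (simp add: e_def)
  also have "\<dots> < cmod ?I * 1"
  proof (intro mult_strict_left_mono)
    have "r / (2 * (r + 1)) < 1" if "0 \<le> r" for r :: real
      using that by (simp add: divide_simps)
    then show "?N / (2 * (?N + 1)) < 1" using N .
  qed (use \<open>?I \<noteq> 0\<close> in \<open>simp only: zero_less_norm_iff not_False_eq_True\<close>)
  finally show False by simp
qed

text \<open>The multiplier \<open>sgn (cnj f)\<close> is an almost everywhere limit of continuous functions,
  which turns orthogonality to continuous functions into \<open>\<integral>|f| = 0\<close>.\<close>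
lemma expo_complete:
  fixes f :: "real^'n \<Rightarrow> complex"
  assumes f: "in_L2 unit_cube f" and orth: "\<And>a. L2_inner unit_cube f (expo a) = 0"
  shows "AE x in lebesgue. x \<in> unit_cube \<longrightarrow> f x = 0"
proof -
  define s where "s x = indicator unit_cube x *\<^sub>R sgn (cnj (f x))" for x
  have fm [measurable]: "f \<in> borel_measurable cubeM" using f by (simp add: in_L2_cubeM)
  have "(\<lambda>x. sgn (cnj (f x))) \<in> borel_measurable cubeM"
    unfolding sgn_div_norm by measurable
  then have "s \<in> borel_measurable lebesgue"
    unfolding s_def[abs_def] by (simp add: borel_measurable_restrict_space_iff unit_cube_lebesgue)
  then have "s measurable_on UNIV"
    by (rule lebesgue_measurable_imp_measurable_on) simp
  then obtain N g where N: "negligible N" and g: "\<And>n. continuous_on UNIV (g n)"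
    and lim: "\<And>x. x \<notin> N \<Longrightarrow> (\<lambda>n. g n x) \<longlonglongrightarrow> s x"
    unfolding measurable_on_def by auto
  have AE_lim: "AE x in lebesgue. (\<lambda>n. g n x) \<longlonglongrightarrow> s x"
    using N lim by (intro AE_I'[of N]) (auto simp: negligible_iff_null_sets)
  \<comment> \<open>Scaling into the closed unit disc gives the uniform bound needed for
    orthogonality and for domination. The limit stays the same because
    \<open>cmod (s x) \<le> 1\<close>.\<close>
  define h where "h n x = g n x / complex_of_real (max 1 (cmod (g n x)))" for n x
  have h1: "cmod (h n x) \<le> 1" for n x
    by (simp add: h_def norm_divide divide_simps)
  have hc: "continuous_on UNIV (h n)" for n
    unfolding h_def by (intro continuous_intros g) (auto simp: max_def)
  have hm: "h n \<in> borel_measurable cubeM" for n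
    by (intro measurable_cubeM borel_measurable_continuous_onI hc)
  have "cmod (s x) \<le> 1" for x
    by (simp add: s_def indicator_def norm_sgn)
  then have s1: "max 1 (cmod (s x)) = 1" for x
    by (metis max.absorb1)
  have "AE x in lebesgue. (\<lambda>n. h n x) \<longlonglongrightarrow> s x"
    using AE_lim
  proof eventually_elim
    case (elim x)
    then have "(\<lambda>n. h n x) \<longlonglongrightarrow> s x / complex_of_real (max 1 (cmod (s x)))"
      unfolding h_def by (intro tendsto_intros) (auto simp: max_def)
    then show ?case by (simp add: s1)
  qed
  then have h_lim: "AE x in cubeM. (\<lambda>n. h n x) \<longlonglongrightarrow> s x"
    by (subst AE_restrict_space_iff) (auto simp: unit_cube_lebesgue)
  have int_f: "integrable cubeM (\<lambda>x. cmod (f x))"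
    using in_L2_imp_integrable[OF f, of "\<lambda>_. 1" 1] by simp
  have "(\<integral>x. f x * h n x \<partial>cubeM) = 0" for n
  proof -
    \<comment> \<open>Orthogonality is available for real continuous multipliers, so
      \<open>h n\<close> is split into real and imaginary part.\<close>
    have Re: "(\<integral>x. f x * complex_of_real (Re (h n x)) \<partial>cubeM) = 0"
      by (rule continuous_orthogonal[OF f orth, where B=1])
        (auto intro!: continuous_intros hc order_trans[OF abs_Re_le_cmod h1])
    have Im: "(\<integral>x. f x * complex_of_real (Im (h n x)) \<partial>cubeM) = 0"
      by (rule continuous_orthogonal[OF f orth, where B=1])
        (auto intro!: continuous_intros hc order_trans[OF abs_Im_le_cmod h1])
    have int: "integrable cubeM (\<lambda>x. f x * complex_of_real (Re (h n x)))"
      "integrable cubeM (\<lambda>x. f x * complex_of_real (Im (h n x)))"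
      using hm by (auto intro!: in_L2_imp_integrable[OF f, where B=1]
          order_trans[OF abs_Re_le_cmod h1] order_trans[OF abs_Im_le_cmod h1])
    have "(\<integral>x. f x * h n x \<partial>cubeM)
        = (\<integral>x. f x * complex_of_real (Re (h n x)) + \<i> * (f x * complex_of_real (Im (h n x))) \<partial>cubeM)"
      by (subst complex_eq[of "h n _"]) (simp add: distrib_left mult_ac)
    also have "\<dots> = 0"
      using int by (simp add: Re Im)
    finally show ?thesis .
  qed
  moreover have "(\<lambda>n. \<integral>x. f x * h n x \<partial>cubeM) \<longlonglongrightarrow> (\<integral>x. f x * s x \<partial>cubeM)"
  proof (rule integral_dominated_convergence[where w="\<lambda>x. cmod (f x)"])
    show "(\<lambda>x. f x * s x) \<in> borel_measurable cubeM"
      using \<open>s \<in> borel_measurable lebesgue\<close> fm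
      by (intro borel_measurable_times) (auto intro: measurable_restrict_space1)
    show "AE x in cubeM. (\<lambda>n. f x * h n x) \<longlonglongrightarrow> f x * s x"
      using h_lim by eventually_elim (intro tendsto_intros)
    show "AE x in cubeM. cmod (f x * h n x) \<le> cmod (f x)" for n
      using h1 by (auto simp: norm_mult intro!: AE_I2 mult_left_le)
  qed (use hm fm int_f in auto)
  ultimately have "(\<integral>x. f x * s x \<partial>cubeM) = 0"
    by (simp add: LIMSEQ_const_iff)
  moreover have "(\<integral>x. f x * s x \<partial>cubeM) = (\<integral>x. complex_of_real (cmod (f x)) \<partial>cubeM)"
  proof (rule Bochner_Integration.integral_cong[OF refl])
    fix x :: "real^'n" assume "x \<in> space cubeM"
    then have "s x = cnj (f x) / complex_of_real (cmod (f x))"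
      by (simp add: space_cubeM s_def sgn_eq)
    then show "f x * s x = complex_of_real (cmod (f x))"
      by (cases "f x = 0")
        (simp_all add: complex_norm_square[symmetric] power2_eq_square del: of_real_power)
  qed
  ultimately have "(\<integral>x. cmod (f x) \<partial>cubeM) = 0"
    by simp
  then have "AE x in cubeM. f x = 0"
    using integral_nonneg_eq_0_iff_AE[OF int_f] by simp
  then show ?thesis
    by (subst (asm) AE_restrict_space_iff) (auto simp: unit_cube_lebesgue)
qed

text \<open>The inner product depends continuously on the frequency, by dominated convergence, and a
  set with null complement meets every ball.\<close>

lemma L2_inner_expo_AE_zero:
  fixes f :: "real^'n \<Rightarrow> complex"
  assumes f: "in_L2 unit_cube f" and AE0: "AE a in lborel. L2_inner unit_cube f (expo a) = 0"
  shows "L2_inner unit_cube f (expo a) = 0"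
proof -
  have "\<exists>b\<in>ball a (1 / Suc n). L2_inner unit_cube f (expo b) = 0" for n
  proof (rule ccontr)
    assume *: "\<not> ?thesis"
    have "AE b in lborel. b \<notin> ball a (1 / Suc n)"
      using AE0 by eventually_elim (use * in blast)
    then have "ball a (1 / Suc n) \<in> null_sets lborel"
      by (simp add: AE_iff_null_sets)
    then have "negligible (ball a (1 / Suc n))"
      by (simp add: negligible_iff_null_sets null_sets_completionI)
    then show False
      using open_not_negligible[of "ball a (1 / Suc n)"] by simp
  qed
  then obtain b where b: "\<And>n. b n \<in> ball a (1 / Suc n)" and b0: "\<And>n. L2_inner unit_cube f (expo (b n)) = 0"
    by metis
  have "norm (dist (b n) a) \<le> 1 / real (Suc n)" for n
    using b[of n] by (simp only: mem_ball dist_commute real_norm_def abs_of_nonneg[OF zero_le_dist] less_imp_le)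
  then have "(\<lambda>n. dist (b n) a) \<longlonglongrightarrow> 0"
    by (intro Lim_null_comparison[OF always_eventually LIMSEQ_Suc[OF lim_1_over_n]] allI)
  then have lim: "b \<longlonglongrightarrow> a" by (rule tendsto_dist_iff[THEN iffD2])
  have "(\<lambda>n. \<integral>x. f x * cnj (expo (b n) x) \<partial>cubeM) \<longlonglongrightarrow> (\<integral>x. f x * cnj (expo a x) \<partial>cubeM)"
  proof (rule integral_dominated_convergence[where w="\<lambda>x. cmod (f x)"])
    show "integrable cubeM (\<lambda>x. cmod (f x))"
      using in_L2_imp_integrable[OF f, of "\<lambda>_. 1" 1] by simp
    show "AE x in cubeM. (\<lambda>n. f x * cnj (expo (b n) x)) \<longlonglongrightarrow> f x * cnj (expo a x)"
      unfolding expo_def by (intro AE_I2 tendsto_intros lim)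
  qed (use f in \<open>auto simp: norm_mult in_L2_cubeM\<close>)
  then show ?thesis
    using b0 by (simp add: L2_inner_cubeM LIMSEQ_const_iff)
qed

section \<open>Periodic sets of translations\<close>


text \<open>Gaussian elimination, by induction on the equations: unless equation \<open>e0\<close>
  is trivial, a pivot \<open>q\<close> lets it eliminate one unknown from the others, and the strict
  inequality of the cardinalities survives.\<close>

lemma homogeneous_system_nontrivial_solution:
  fixes a :: "'i \<Rightarrow> 'e \<Rightarrow> 'k::field"
  assumes "finite E" "finite I" "card E < card I"
  shows "\<exists>c. (\<exists>i\<in>I. c i \<noteq> 0) \<and> (\<forall>e\<in>E. (\<Sum>i\<in>I. c i * a i e) = 0)"
  using assms
proof (induction E arbitrary: I a rule: finite_induct)
  case empty
  then have "I \<noteq> {}" by auto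
  then show ?case by (intro exI[of _ "\<lambda>_. 1"]) auto
next
  case (insert e0 E)
  show ?case
  proof (cases "\<forall>i\<in>I. a i e0 = 0")
    case True
    have "card E < card I" using insert by simp
    then obtain c where "\<exists>i\<in>I. c i \<noteq> 0" "\<forall>e\<in>E. (\<Sum>i\<in>I. c i * a i e) = 0"
      using insert.IH[OF insert.prems(1)] by blast
    with True show ?thesis by (intro exI[of _ c]) auto
  next
    case False
    then obtain q where q: "q \<in> I" "a q e0 \<noteq> 0" by blast
    define b where "b i e = a i e - a i e0 / a q e0 * a q e" for i e
    have "card E < card (I - {q})" using insert q by simp
    then obtain c where c: "\<exists>i\<in>I - {q}. c i \<noteq> 0" "\<forall>e\<in>E. (\<Sum>i\<in>I - {q}. c i * b i e) = 0"
      using insert.IH[of "I - {q}" b] insert.prems(1) by blast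
    \<comment> \<open>The value of the eliminated unknown is the one that equation \<open>e0\<close>
      forces.\<close>
    define c' where "c' = c(q := - (\<Sum>i\<in>I - {q}. c i * (a i e0 / a q e0)))"
    have "(\<Sum>i\<in>I. c' i * a i e) = (\<Sum>i\<in>I - {q}. c i * b i e)" for e
    proof -
      have "(\<Sum>i\<in>I. c' i * a i e) = c' q * a q e + (\<Sum>i\<in>I - {q}. c' i * a i e)"
        using q insert.prems(1) by (simp add: sum.remove)
      also have "(\<Sum>i\<in>I - {q}. c' i * a i e) = (\<Sum>i\<in>I - {q}. c i * a i e)"
        by (intro sum.cong) (auto simp: c'_def)
      also have "c' q * a q e = - (\<Sum>i\<in>I - {q}. c i * (a i e0 / a q e0) * a q e)"
        by (simp add: c'_def sum_distrib_right)
      finally show ?thesis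
        by (simp add: b_def right_diff_distrib sum_subtractf mult.assoc)
    qed
    moreover have "b i e0 = 0" for i
      using q by (simp add: b_def)
    ultimately have "\<forall>e\<in>insert e0 E. (\<Sum>i\<in>I. c' i * a i e) = 0"
      using c(2) by simp
    moreover have "\<exists>i\<in>I. c' i \<noteq> 0"
      using c(1) by (auto simp: c'_def)
    ultimately show ?thesis by blast
  qed
qed

lemma lattice_diff: "a \<in> lattice R \<Longrightarrow> b \<in> lattice R \<Longrightarrow> a - b \<in> lattice R"
  unfolding lattice_def
  by clarsimp (metis (no_types, lifting) Ints_diff matrix_vector_mult_diff_distrib vector_minus_component)

lemma zero_in_lattice: "0 \<in> lattice R"
  unfolding lattice_def by (auto intro!: exI[of _ 0])

text \<open>Holds because the lattice contains 0 and is closed under differences. It gives condition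
  (3) its pairwise form.\<close>

lemma sumset_diffset:
  "sumset (lattice R) (diffset E E) = diffset (sumset (lattice R) E) (sumset (lattice R) E)"
proof (intro equalityI subsetI)
  fix x assume "x \<in> sumset (lattice R) (diffset E E)"
  then obtain m e e' where "m \<in> lattice R" "e \<in> E" "e' \<in> E" "x = (m + e) - (0 + e')"
    by (auto simp: sumset_def diffset_def)
  then show "x \<in> diffset (sumset (lattice R) E) (sumset (lattice R) E)"
    unfolding sumset_def diffset_def using zero_in_lattice by blast
next
  fix x assume "x \<in> diffset (sumset (lattice R) E) (sumset (lattice R) E)"
  then obtain m e m' e' where "m \<in> lattice R" "e \<in> E" "m' \<in> lattice R" "e' \<in> E"
    "x = (m - m') + (e - e')"
    by (auto simp: sumset_def diffset_def)
  then show "x \<in> sumset (lattice R) (diffset E E)"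
    unfolding sumset_def diffset_def using lattice_diff by blast
qed

lemma diff_in_Z_cube_iff:
  fixes R :: "real^'n^'n"
  shows
  "sumset (lattice R) (diffset E E) \<subseteq> Z_cube \<union> {0} \<longleftrightarrow>
    (\<forall>a\<in>sumset (lattice R) E. \<forall>b\<in>sumset (lattice R) E. a \<noteq> b \<longrightarrow> a - b \<in> Z_cube)"
proof -
  have "diffset T T \<subseteq> Z_cube \<union> {0} \<longleftrightarrow> (\<forall>a\<in>T. \<forall>b\<in>T. a \<noteq> b \<longrightarrow> a - b \<in> Z_cube)" for T :: "(real^'n) set"
    unfolding diffset_def subset_iff by simp (metis right_minus_eq)
  then show ?thesis unfolding sumset_diffset .
qed

text \<open>Corners of half-open unit cubes with a common point differ by less than 1 in every
  coordinate, which leaves no room for a nonzero integer.\<close>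

lemma Z_cube_disjoint:
  assumes "a - b \<in> Z_cube" "x - a \<in> unit_cube" "x - b \<in> unit_cube"
  shows False
proof -
  obtain j where j: "a $ j - b $ j \<in> \<int>" "a $ j - b $ j \<noteq> 0"
    using assms(1) by (auto simp: Z_cube_def)
  have "0 \<le> x $ j - a $ j" "x $ j - a $ j < 1" "0 \<le> x $ j - b $ j" "x $ j - b $ j < 1"
    using assms(2,3) by (auto simp: unit_cube_def)
  then have "\<bar>a $ j - b $ j\<bar> < 1" by linarith
  with j show False by (metis Ints_nonzero_abs_less1)
qed

lemma sum_indicator_le_1:
  fixes A :: "(real^'n) set"
  assumes "finite A" "\<And>a b. a \<in> A \<Longrightarrow> b \<in> A \<Longrightarrow> a \<noteq> b \<Longrightarrow> a - b \<in> Z_cube"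
  shows "(\<Sum>a\<in>A. indicator unit_cube (x - a)) \<le> (1::ennreal)"
proof (cases "\<exists>b\<in>A. x - b \<in> unit_cube")
  case True
  then obtain b where b: "b \<in> A" "x - b \<in> unit_cube" by blast
  have "(\<Sum>a\<in>A. indicator unit_cube (x - a)) = (\<Sum>a\<in>A. if a = b then 1 else (0::ennreal))"
    using assms(2)[OF _ b(1)] b(2) by (intro sum.cong) (auto simp: indicator_def dest: Z_cube_disjoint)
  then show ?thesis using assms(1) b(1) by simp
next
  case False
  then have "(\<Sum>a\<in>A. indicator unit_cube (x - a)) = (0::ennreal)"
    by (intro sum.neutral) auto
  then show ?thesis by simp
qed

text \<open>The transposed inverse cancels \<open>R\<close>, which leaves the inner product of two
  integer vectors.\<close>

lemma dual_lattice_inner_Ints: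
  fixes R B :: "real^'n^'n"
  assumes "B ** R = mat 1" "m \<in> lattice R" "m' \<in> lattice (transpose B)"
  shows "m \<bullet> m' \<in> \<int>"
proof -
  obtain k k' where k: "m = R *v k" "\<forall>i. k $ i \<in> \<int>" "m' = transpose B *v k'" "\<forall>i. k' $ i \<in> \<int>"
    using assms by (auto simp: lattice_def)
  have "m' \<bullet> m = k' \<bullet> (B *v (R *v k))"
    unfolding k transpose_matrix_vector by (rule dot_lmul_matrix)
  also have "\<dots> = k' \<bullet> k"
    using assms(1) by (simp add: matrix_vector_mul_assoc)
  also have "\<dots> \<in> \<int>"
    unfolding inner_vec_def using k by (auto intro!: Ints_sum Ints_mult)
  finally show ?thesis by (simp add: inner_commute)
qed

lemma expo_Ints: "a \<bullet> x \<in> \<int> \<Longrightarrow> expo a x = 1"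
  using exp_integer_2pi[of "a \<bullet> x"] unfolding expo_def
  by (simp add: mult_ac)

lemma integral_lborel_translate:
  fixes f :: "'a::euclidean_space \<Rightarrow> 'b::{banach, second_countable_topology}"
  assumes "f \<in> borel_measurable borel"
  shows "(\<integral>x. f (x + c) \<partial>lborel) = (\<integral>x. f x \<partial>lborel)"
proof -
  have "(\<integral>x. f x \<partial>lborel) = (\<integral>x. f x \<partial>distr lborel borel ((+) c))"
    by (simp add: lborel_distr_plus)
  also have "\<dots> = (\<integral>x. f (c + x) \<partial>lborel)"
    using assms by (subst integral_distr) auto
  finally show ?thesis by (simp add: add.commute)
qed


lemma indicator_unit_cube_integral: "(\<integral>\<^sup>+x. indicator unit_cube x \<partial>(lborel :: (real^'n) measure)) = 1"
  by (simp add: emeasure_unit_cube)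

section \<open>The three conditions for the periodic set \<open>M + E\<close>\<close>

context
  fixes R :: "real^'n^'n" and E :: "(real^'n) set" and l :: "nat \<Rightarrow> real^'n"
  assumes R: "invertible R" and E: "finite E" and direct: "lattice R \<inter> diffset E E = {0}"
    and l: "bij_betw l UNIV (lattice R)"
begin

lemma l_in_lattice: "l i \<in> lattice R"
  using l by (auto simp: bij_betw_def)

text \<open>The condition \<open>direct\<close> makes \<open>(i, e) \<mapsto> l i + e\<close>
  injective, so partial double sums run over genuine finite subsets of \<open>M + E\<close>, to
  which packing and Bessel bounds apply.\<close>

lemma partial_sum_reindex:
  fixes g :: "real^'n \<Rightarrow> 'a::comm_monoid_add"
  obtains A where "finite A" "A \<subseteq> sumset (lattice R) E"
    "\<And>x. (\<Sum>i<n. \<Sum>e\<in>E. g (x - l i - e)) = (\<Sum>a\<in>A. g (x - a))"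
proof -
  define h where "h = (\<lambda>(i, e). l i + e)"
  have inj: "inj_on h ({..<n} \<times> E)"
  proof (rule inj_onI, clarsimp simp: h_def)
    fix i e j e' assume e: "e \<in> E" "e' \<in> E" and eq: "l i + e = l j + e'"
    have "e - e' = l j - l i" using eq by (simp add: algebra_simps)
    then have "e - e' \<in> lattice R"
      using lattice_diff[OF l_in_lattice l_in_lattice] by simp
    moreover have "e - e' \<in> diffset E E"
      unfolding diffset_def using e by blast
    ultimately have "e - e' \<in> lattice R \<inter> diffset E E" by blast
    then have "e = e'" using direct by simp
    with eq have "l i = l j" by simp
    then have "i = j" using l by (metis bij_betw_imp_inj_on injD)
    with \<open>e = e'\<close> show "i = j \<and> e = e'" by simp
  qed
  have "(\<Sum>i<n. \<Sum>e\<in>E. g (x - l i - e)) = (\<Sum>a\<in>h ` ({..<n} \<times> E). g (x - a))" for x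
    unfolding sum.reindex[OF inj] sum.cartesian_product by (simp add: h_def case_prod_unfold diff_diff_eq)
  moreover have "h ` ({..<n} \<times> E) \<subseteq> sumset (lattice R) E"
    using l_in_lattice by (auto simp: h_def sumset_def)
  ultimately show ?thesis
    using that[of "h ` ({..<n} \<times> E)"] E by simp
qed

lemma periodization_le_1:
  fixes g :: "real^'n \<Rightarrow> ennreal"
  assumes "\<And>A. finite A \<Longrightarrow> A \<subseteq> sumset (lattice R) E \<Longrightarrow> (\<Sum>a\<in>A. g (x - a)) \<le> 1"
  shows "(\<Sum>i. \<Sum>e\<in>E. g (x - l i - e)) \<le> 1"
proof (rule suminf_le_const[OF summableI])
  fix n
  obtain A where "finite A" "A \<subseteq> sumset (lattice R) E"
    "(\<Sum>i<n. \<Sum>e\<in>E. g (x - l i - e)) = (\<Sum>a\<in>A. g (x - a))"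
    using partial_sum_reindex[of g n] by metis
  with assms show "(\<Sum>i<n. \<Sum>e\<in>E. g (x - l i - e)) \<le> 1" by simp
qed

lemma cube_periodization_le_1:
  assumes "\<And>a b. a \<in> sumset (lattice R) E \<Longrightarrow> b \<in> sumset (lattice R) E \<Longrightarrow> a \<noteq> b \<Longrightarrow> a - b \<in> Z_cube"
  shows "(\<Sum>i. \<Sum>e\<in>E. indicator unit_cube (x - l i - e) :: ennreal) \<le> 1"
  using assms by (intro periodization_le_1 sum_indicator_le_1) blast+

lemma Z_cube_imp_card_le:
  assumes "\<And>a b. a \<in> sumset (lattice R) E \<Longrightarrow> b \<in> sumset (lattice R) E \<Longrightarrow> a \<noteq> b \<Longrightarrow> a - b \<in> Z_cube"
  shows "real (card E) \<le> \<bar>det R\<bar>"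
proof -
  have "of_nat (card E) \<le> 1 * emeasure lborel (fund_domain R)"
    by (rule packing_card_le[OF fund_domain_borel[OF R] fund_domain_unique_index[OF R l] _
          indicator_unit_cube_integral cube_periodization_le_1[OF assms]]) auto
  then have "ennreal (real (card E)) \<le> ennreal \<bar>det R\<bar>"
    by (simp add: emeasure_fund_domain[OF R] ennreal_of_nat_eq_real_of_nat)
  then show ?thesis by simp
qed

lemma card_eq_emeasure:
  assumes "real (card E) = \<bar>det R\<bar>"
  shows "of_nat (card E) = emeasure lborel (fund_domain R)"
  using assms by (simp add: emeasure_fund_domain[OF R] ennreal_of_nat_eq_real_of_nat)

lemma Z_cube_imp_tile:
  assumes card: "real (card E) = \<bar>det R\<bar>"
    and Z: "\<And>a b. a \<in> sumset (lattice R) E \<Longrightarrow> b \<in> sumset (lattice R) E \<Longrightarrow> a \<noteq> b \<Longrightarrow> a - b \<in> Z_cube"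
  shows "is_tile unit_cube (sumset (lattice R) E)"
proof -
  have mem: "x \<in> (\<lambda>y. y + t) ` unit_cube \<longleftrightarrow> x - t \<in> unit_cube" for x t :: "real^'n"
    by (force simp: image_iff intro: bexI[where x="x - t"])
  have "AE x in lborel. (\<Sum>i. \<Sum>e\<in>E. indicator unit_cube (x - l i - e) :: ennreal) = 1"
    by (rule packing_imp_tiling_AE[OF fund_domain_borel[OF R] fund_domain_unique_index[OF R l] _
          indicator_unit_cube_integral cube_periodization_le_1[OF Z] card_eq_emeasure[OF card]]) auto
  then have "AE x in lborel. x \<in> (\<Union>t\<in>sumset (lattice R) E. (\<lambda>x. x + t) ` unit_cube)"
  proof eventually_elim
    case (elim x)
    \<comment> \<open>At a point outside all cubes the series would be 0 and not 1.\<close>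
    have "\<exists>i. \<exists>e\<in>E. x - l i - e \<in> unit_cube"
    proof (rule ccontr)
      assume "\<not> ?thesis"
      then have "(\<Sum>i. \<Sum>e\<in>E. indicator unit_cube (x - l i - e) :: ennreal) = (\<Sum>i. 0)"
        by (intro suminf_cong sum.neutral) auto
      with elim show False by simp
    qed
    then obtain i e where "e \<in> E" "x - (l i + e) \<in> unit_cube"
      by (auto simp: diff_diff_eq)
    then show ?case
      unfolding UN_iff mem using l_in_lattice by (auto simp: sumset_def)
  qed
  then obtain N where N: "\<And>x. x \<in> space lborel - N \<Longrightarrow> x \<in> (\<Union>t\<in>sumset (lattice R) E. (\<lambda>x. x + t) ` unit_cube)"
    "N \<in> null_sets lborel"
    by (rule AE_E3) (rule that)
  then have "negligible N"
    by (simp add: negligible_iff_null_sets null_sets_completionI)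
  then have "negligible (UNIV - (\<Union>t\<in>sumset (lattice R) E. (\<lambda>x. x + t) ` unit_cube))"
    by (rule negligible_subset) (use N(1) in auto)
  moreover have "(\<lambda>x. x + t) ` unit_cube \<inter> (\<lambda>x. x + t') ` unit_cube = {}"
    if "t \<in> sumset (lattice R) E" "t' \<in> sumset (lattice R) E" "t \<noteq> t'" for t t'
    using Z_cube_disjoint[OF Z[OF that]] mem by blast
  ultimately show ?thesis
    unfolding is_tile_def by (auto simp: negligible_iff_null_sets)
qed

lemma tile_imp_Z_cube:
  assumes "is_tile unit_cube (sumset (lattice R) E)"
    and "a \<in> sumset (lattice R) E" "b \<in> sumset (lattice R) E" "a \<noteq> b"
  shows "a - b \<in> Z_cube"
  using Keller[OF tile_exact[OF assms(1)] assms(2-4)] assms(4) by (auto simp: Z_cube_def)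

text \<open>The periodized indicator equals 1 everywhere: Keller's theorem bounds it above, and the
  term of the cube covering \<open>x\<close> bounds it below. Integration over a fundamental domain
  compares \<open>card E\<close> with the volume.\<close>

lemma tile_imp_card:
  assumes tile: "is_tile unit_cube (sumset (lattice R) E)"
  shows "real (card E) = \<bar>det R\<bar>"
proof -
  have "(\<Sum>i. \<Sum>e\<in>E. indicator unit_cube (x - l i - e) :: ennreal) = 1" for x
  proof (rule antisym)
    show "(\<Sum>i. \<Sum>e\<in>E. indicator unit_cube (x - l i - e) :: ennreal) \<le> 1"
      by (rule cube_periodization_le_1) (rule tile_imp_Z_cube[OF tile])
    obtain t where t: "t \<in> sumset (lattice R) E" "\<forall>i. t $ i \<le> x $ i \<and> x $ i < t $ i + 1"
      using tile_exact[OF tile] unfolding exact_tiling_def by blast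
    then obtain m e0 where m: "t = m + e0" "m \<in> lattice R" "e0 \<in> E"
      unfolding sumset_def by blast
    then obtain j where "m = l j" using l by (metis bij_betw_imp_surj_on imageE)
    with m have j: "t = l j + e0" "e0 \<in> E" by simp_all
    have "\<forall>i. 0 \<le> x $ i - t $ i \<and> x $ i - t $ i < 1"
    proof
      fix i
      show "0 \<le> x $ i - t $ i \<and> x $ i - t $ i < 1"
        using spec[OF t(2), of i] by linarith
    qed
    then have "x - l j - e0 \<in> unit_cube"
      by (simp add: unit_cube_def j diff_diff_eq)
    then have "1 = (indicator unit_cube (x - l j - e0) :: ennreal)" by simp
    also have "\<dots> \<le> (\<Sum>e\<in>E. indicator unit_cube (x - l j - e))"
      by (rule member_le_sum) (use j E in auto)
    also have "\<dots> = (\<Sum>i\<in>{j}. \<Sum>e\<in>E. indicator unit_cube (x - l i - e))"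
      by simp
    also have "\<dots> \<le> (\<Sum>i. \<Sum>e\<in>E. indicator unit_cube (x - l i - e))"
      by (rule sum_le_suminf) auto
    finally show "1 \<le> (\<Sum>i. \<Sum>e\<in>E. indicator unit_cube (x - l i - e) :: ennreal)" .
  qed
  then have "of_nat (card E) * (\<integral>\<^sup>+x. indicator unit_cube x \<partial>(lborel :: (real^'n) measure))
      = (\<integral>\<^sup>+x. 1 * indicator (fund_domain R) x \<partial>lborel)"
    using nn_integral_periodization[OF fund_domain_borel[OF R] fund_domain_unique_index[OF R l],
        of "indicator unit_cube" E] by simp
  then have "ennreal (real (card E)) = ennreal \<bar>det R\<bar>"
    using fund_domain_borel[OF R]
    by (simp add: indicator_unit_cube_integral emeasure_fund_domain[OF R] ennreal_of_nat_eq_real_of_nat)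
  then show ?thesis by simp
qed

text \<open>Wherever the periodized \<open>(cmod (cube_FT z))\<^sup>2\<close> reaches 1, the Bessel
  remainders of \<open>expo x\<close> tend to 0, so \<open>f\<close> is orthogonal to
  \<open>expo x\<close>. This happens for almost every \<open>x\<close>; continuity in the frequency
  extends it to all, and the exponentials with all frequencies are complete.\<close>

lemma Z_cube_imp_complete:
  assumes card: "real (card E) = \<bar>det R\<bar>"
    and Z: "\<And>a b. a \<in> sumset (lattice R) E \<Longrightarrow> b \<in> sumset (lattice R) E \<Longrightarrow> a \<noteq> b \<Longrightarrow> a - b \<in> Z_cube"
    and f: "in_L2 unit_cube f" and f_orth: "\<And>a. a \<in> sumset (lattice R) E \<Longrightarrow> L2_inner unit_cube f (expo a) = 0"
  shows "AE x in lebesgue. x \<in> unit_cube \<longrightarrow> f x = 0"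
proof -
  define g :: "real^'n \<Rightarrow> real" where "g z = (cmod (cube_FT z))\<^sup>2" for z
  have orth: "cube_FT (a - b) = 0"
    if "a \<in> sumset (lattice R) E" "b \<in> sumset (lattice R) E" "a \<noteq> b" for a b
    using Z[OF that] by (simp add: cube_FT_eq_0_iff)
  have "(\<Sum>a\<in>A. ennreal (g (x - a))) \<le> 1" if "finite A" "A \<subseteq> sumset (lattice R) E" for A x
  proof -
    have "(\<Sum>a\<in>A. g (x - a)) \<le> 1"
      unfolding g_def by (rule bessel_inequality) (use that orth in auto)
    then show ?thesis by (simp add: sum_ennreal g_def)
  qed
  then have le_1: "(\<Sum>i. \<Sum>e\<in>E. ennreal (g (x - l i - e))) \<le> 1" for x
    by (intro periodization_le_1) auto
  have "AE x in lborel. (\<Sum>i. \<Sum>e\<in>E. ennreal (g (x - l i - e))) = 1"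
    by (rule packing_imp_tiling_AE[OF fund_domain_borel[OF R] fund_domain_unique_index[OF R l] _ _ le_1
          card_eq_emeasure[OF card]]) (auto simp: g_def nn_integral_cube_FT_square)
  then have "AE x in lborel. L2_inner unit_cube f (expo x) = 0"
  proof eventually_elim
    case (elim x)
    define C where "C = (\<integral>y. (cmod (f y))\<^sup>2 \<partial>cubeM)"
    let ?s = "\<lambda>n. \<Sum>i<n. \<Sum>e\<in>E. g (x - l i - e)"
    have "(\<lambda>n. \<Sum>i<n. \<Sum>e\<in>E. ennreal (g (x - l i - e))) \<longlonglongrightarrow> 1"
      using summable_LIMSEQ[OF summableI, of "\<lambda>i. \<Sum>e\<in>E. ennreal (g (x - l i - e))"] elim by simp
    then have "(\<lambda>n. ennreal (?s n)) \<longlonglongrightarrow> ennreal 1"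
      by (simp add: sum_ennreal g_def sum_nonneg)
    then have lim: "?s \<longlonglongrightarrow> 1"
      by (subst (asm) tendsto_ennreal_iff) (auto simp: g_def sum_nonneg)
    \<comment> \<open>First \<open>n\<close> tends to infinity with \<open>t\<close> fixed, which
      removes the remainder term; only afterwards does \<open>t\<close> tend to 0.\<close>
    have bound: "2 * cmod (L2_inner unit_cube f (expo x)) \<le> t * C" if t: "t > 0" for t
    proof (rule LIMSEQ_le_const)
      show "(\<lambda>n. t * C + (1 - ?s n) / t) \<longlonglongrightarrow> t * C"
        using tendsto_add[OF tendsto_const[of "t * C"]
            tendsto_divide[OF tendsto_diff[OF tendsto_const[of 1] lim] tendsto_const[of t]]] t
        by simp
      have "2 * cmod (L2_inner unit_cube f (expo x)) \<le> t * C + (1 - ?s n) / t" for n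
      proof -
        obtain A where A: "finite A" "A \<subseteq> sumset (lattice R) E" "?s n = (\<Sum>a\<in>A. g (x - a))"
          using partial_sum_reindex[of g n] by metis
        have "2 * cmod (L2_inner unit_cube f (expo x)) \<le> t * C + (1 - (\<Sum>a\<in>A. g (x - a))) / t"
          unfolding C_def g_def
          by (rule inner_le_bessel_rem[OF A(1) _ f _ t]) (use A(2) in \<open>auto intro!: orth f_orth\<close>)
        then show ?thesis by (simp only: A(3))
      qed
      then show "\<exists>N. \<forall>n\<ge>N. 2 * cmod (L2_inner unit_cube f (expo x)) \<le> t * C + (1 - ?s n) / t"
        by blast
    qed
    have "((\<lambda>t. t * C) \<longlongrightarrow> 0 * C) (at_right 0)"
      by (intro tendsto_intros)
    then have "2 * cmod (L2_inner unit_cube f (expo x)) \<le> 0 * C"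
      by (rule tendsto_lowerbound)
        (auto intro!: eventually_at_rightI[of 0 1] bound simp: trivial_limit_at_right_real)
    then show ?case by simp
  qed
  then show ?thesis
    by (intro expo_complete[OF f] L2_inner_expo_AE_zero[OF f])
qed

text \<open>If \<open>card E < \<bar>det R\<bar>\<close>, some coset of the dual lattice has more than \<open>card E\<close> points in the open cube.
  A combination of indicators of small balls around these points is orthogonal to all exponentials as soon
  as its coefficients satisfy one linear equation per element of \<open>E\<close>.\<close>
lemma complete_imp_card_ge:
  assumes complete: "\<And>f. in_L2 unit_cube f \<Longrightarrow> (\<And>a. a \<in> sumset (lattice R) E \<Longrightarrow> L2_inner unit_cube f (expo a) = 0)
      \<Longrightarrow> AE x in lebesgue. x \<in> unit_cube \<longrightarrow> f x = 0"
  shows "\<bar>det R\<bar> \<le> real (card E)"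
proof (rule ccontr)
  assume less: "\<not> ?thesis"
  obtain B where B: "R ** B = mat 1" "B ** R = mat 1"
    using R by (auto simp: invertible_def)
  \<comment> \<open>The transposed inverse generates the dual lattice, whose fundamental domain has
    volume \<open>1 / \<bar>det R\<bar>\<close>.\<close>
  let ?R = "transpose B"
  have R': "invertible ?R"
    using B by (intro transpose_invertible) (auto simp: invertible_def)
  have "det B * det R = 1"
    using det_mul[of B R] B(2) by simp
  then have det: "\<bar>det ?R\<bar> * \<bar>det R\<bar> = 1"
    unfolding det_transpose abs_mult[symmetric] by simp
  obtain k :: "nat \<Rightarrow> real^'n" where k: "bij_betw k UNIV (lattice ?R)"
    using lattice_enumeration[OF R'] .
  have box: "(\<integral>\<^sup>+x. indicator (box 0 1) x \<partial>(lborel :: (real^'n) measure)) = 1"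
  proof -
    have 1: "(1::real^'n) \<bullet> b = 1" if "b \<in> Basis" for b
      using that by (auto simp: Basis_vec_def inner_axis)
    have "emeasure lborel (box 0 (1::real^'n)) = 1"
      by (subst emeasure_lborel_box) (auto simp: 1)
    then show ?thesis by simp
  qed
  \<comment> \<open>The sum counts the points \<open>x - k i\<close> in the open cube, and its mean
    value over \<open>x\<close> is \<open>\<bar>det R\<bar>\<close>. If it never exceeded
    \<open>card E\<close>, the packing bound, with \<open>{0}\<close> as the set of translations and
    \<open>c = card E\<close>, would contradict \<open>card E < \<bar>det R\<bar>\<close>.\<close>
  have "\<exists>x. \<not> (\<Sum>i. \<Sum>e\<in>{0}. indicator (box 0 1) (x - k i - e)) \<le> (of_nat (card E) :: ennreal)"
  proof (rule ccontr)
    assume "\<not> ?thesis"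
    then have "of_nat (card {0::real^'n}) \<le> of_nat (card E) * emeasure lborel (fund_domain ?R)"
      by (intro packing_card_le[OF fund_domain_borel[OF R'] fund_domain_unique_index[OF R' k] _ box]) auto
    then have "ennreal 1 \<le> ennreal (real (card E) * \<bar>det ?R\<bar>)"
      by (simp add: emeasure_fund_domain[OF R'] ennreal_of_nat_eq_real_of_nat ennreal_mult)
    then have "1 \<le> real (card E) * \<bar>det ?R\<bar>"
      by (subst (asm) ennreal_le_iff) auto
    then have "\<bar>det R\<bar> \<le> real (card E) * \<bar>det ?R\<bar> * \<bar>det R\<bar>"
      using mult_right_mono[of 1 "real (card E) * \<bar>det ?R\<bar>" "\<bar>det R\<bar>"] by simp
    with less det show False by (simp add: mult.assoc)
  qed
  then obtain x where "\<not> (\<Sum>i. indicator (box 0 1) (x - k i)) \<le> (of_nat (card E) :: ennreal)"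
    by auto
  then obtain n where n: "\<not> (\<Sum>i<n. indicator (box 0 1) (x - k i)) \<le> (of_nat (card E) :: ennreal)"
    using suminf_le_const[OF summableI] by metis
  define I where "I = {i\<in>{..<n}. x - k i \<in> box 0 1}"
  have finI: "finite I" by (simp add: I_def)
  have "(\<Sum>i<n. indicator (box 0 1) (x - k i)) = (of_nat (card I) :: ennreal)"
    by (simp add: I_def indicator_def sum.If_cases Int_def)
  with n have cardI: "card E < card I"
    by (simp add: not_le)
  \<comment> \<open>There are \<open>card I\<close> unknowns and only \<open>card E\<close>
    equations.\<close>
  obtain c where c: "\<exists>i\<in>I. c i \<noteq> 0" "\<forall>e\<in>E. (\<Sum>i\<in>I. c i * expo e (k i)) = 0"
    using homogeneous_system_nontrivial_solution[OF E finI cardI, of "\<lambda>i e. expo e (k i)"] by blast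
  have k_inj: "k i = k j \<longleftrightarrow> i = j" for i j
    using k by (metis bij_betw_imp_inj_on injD)
  \<comment> \<open>The radius keeps the balls inside the cube, which is possible as the box is
    open, and makes them pairwise disjoint.\<close>
  obtain r where r: "0 < r" "\<forall>i\<in>I. ball (x - k i) r \<subseteq> box 0 1"
    "\<forall>i\<in>I. \<forall>j\<in>I. i \<noteq> j \<longrightarrow> r \<le> dist (x - k i) (x - k j) / 2"
  proof -
    have "\<forall>\<^sub>F r in at_right 0. \<forall>i\<in>I. ball (x - k i) r \<subseteq> box 0 1"
    proof (intro eventually_ball_finite[OF finI] ballI)
      fix i assume "i \<in> I"
      then obtain d where d: "0 < d" "ball (x - k i) d \<subseteq> box 0 1"
        using open_contains_ball[of "box 0 (1::real^'n)"] by (auto simp: I_def)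
      have "\<forall>\<^sub>F r in at_right 0. r < d"
        by (rule order_tendstoD(2)[OF tendsto_ident_at d(1)])
      then show "\<forall>\<^sub>F r in at_right 0. ball (x - k i) r \<subseteq> box 0 1"
      proof eventually_elim
        case (elim r)
        then show ?case using d(2) subset_ball[of r d "x - k i"] by auto
      qed
    qed
    moreover have "\<forall>\<^sub>F r in at_right 0. \<forall>i\<in>I. \<forall>j\<in>I. i \<noteq> j \<longrightarrow> r \<le> dist (x - k i) (x - k j) / 2"
    proof (intro eventually_ball_finite[OF finI] ballI)
      fix i j
      show "\<forall>\<^sub>F r in at_right 0. i \<noteq> j \<longrightarrow> r \<le> dist (x - k i) (x - k j) / 2"
      proof (cases "i = j")
        case False
        then have "0 < dist (x - k i) (x - k j) / 2" using k_inj by simp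
        then have "\<forall>\<^sub>F r in at_right 0. r < dist (x - k i) (x - k j) / 2"
          by (rule order_tendstoD(2)[OF tendsto_ident_at])
        then show ?thesis by eventually_elim simp
      qed simp
    qed
    moreover have "\<forall>\<^sub>F r in at_right (0::real). 0 < r"
      by (rule eventually_at_right_less)
    ultimately have "\<forall>\<^sub>F r in at_right (0::real). 0 < r \<and> (\<forall>i\<in>I. ball (x - k i) r \<subseteq> box 0 1) \<and>
        (\<forall>i\<in>I. \<forall>j\<in>I. i \<noteq> j \<longrightarrow> r \<le> dist (x - k i) (x - k j) / 2)"
      by eventually_elim simp
    from eventually_happens'[OF trivial_limit_at_right_real this] show ?thesis
      using that by (elim exE conjE)
  qed
  define f where "f y = (\<Sum>i\<in>I. c i * indicator (ball (x - k i) r) y)" for y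
  have box_cube: "box 0 (1::real^'n) \<subseteq> unit_cube"
    by (auto simp: unit_cube_def mem_box_cart less_imp_le)
  have fm: "f \<in> borel_measurable borel"
    unfolding f_def[abs_def]
    by (intro borel_measurable_sum borel_measurable_times borel_measurable_const borel_measurable_indicator) auto
  have "in_L2 unit_cube f"
    unfolding in_L2_cubeM
  proof
    show f_cubeM: "f \<in> borel_measurable cubeM" by (rule measurable_cubeM[OF fm])
    have bound: "cmod (f y) \<le> (\<Sum>i\<in>I. cmod (c i))" for y
      unfolding f_def by (rule order_trans[OF norm_sum sum_mono]) (auto simp: norm_mult indicator_def)
    show "integrable cubeM (\<lambda>y. (cmod (f y))\<^sup>2)"
      by (rule finite_measure.integrable_const_bound[OF finite_measure_cubeM, where B="(\<Sum>i\<in>I. cmod (c i))\<^sup>2"])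
        (use f_cubeM bound in \<open>auto intro!: power_mono\<close>)
  qed
  moreover have "L2_inner unit_cube f (expo a) = 0" if a_mem: "a \<in> sumset (lattice R) E" for a
  proof -
    obtain m e where a: "a = m + e" "m \<in> lattice R" "e \<in> E"
      using a_mem by (auto simp: sumset_def)
    \<comment> \<open>The integral over the ball around the base point \<open>x\<close>; it does not
      depend on \<open>i\<close>, so it can be factored out of the sum.\<close>
    define K where "K = (\<integral>y. indicator (ball x r) y * cnj (expo a y) \<partial>lborel)"
    have ball_int: "(\<integral>y. indicator (ball (x - k i) r) y * cnj (expo a y) \<partial>lborel) = expo e (k i) * K" for i
    proof -
      have "k i \<in> lattice ?R" using k by (auto simp: bij_betw_def)
      \<comment> \<open>On the dual lattice the lattice part \<open>m\<close> of the frequency is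
        invisible, so infinitely many orthogonality conditions reduce to one for each
        \<open>e \<in> E\<close>.\<close>
      then have "expo m (k i) = 1"
        using dual_lattice_inner_Ints[OF B(2) a(2)] by (intro expo_Ints) blast
      then have e: "expo a (k i) = expo e (k i)"
        by (simp add: a expo_add)
      have "(\<integral>y. indicator (ball (x - k i) r) y * cnj (expo a y) \<partial>lborel)
          = (\<integral>y. indicator (ball x r) (y + k i) * (expo e (k i) * cnj (expo a (y + k i))) \<partial>lborel)"
      proof (rule Bochner_Integration.integral_cong[OF refl])
        fix y
        have "dist (x - k i) y = dist x (y + k i)"
          by (simp add: dist_norm algebra_simps)
        moreover have "expo e (k i) * cnj (expo a (y + k i)) = cnj (expo a y)"
          using cnj_expo_times[of a "k i"] by (simp add: expo_add_right e mult_ac)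
        ultimately show "indicator (ball (x - k i) r) y * cnj (expo a y)
            = indicator (ball x r) (y + k i) * (expo e (k i) * cnj (expo a (y + k i)))"
          by (simp add: indicator_def)
      qed
      also have "\<dots> = (\<integral>y. indicator (ball x r) y * (expo e (k i) * cnj (expo a y)) \<partial>lborel)"
        by (rule integral_lborel_translate)
          (intro borel_measurable_times borel_measurable_const borel_measurable_indicator
            borel_measurable_cnj borel_measurable_expo, auto)
      also have "\<dots> = (\<integral>y. expo e (k i) * (indicator (ball x r) y * cnj (expo a y)) \<partial>lborel)"
        by (simp add: mult_ac)
      finally show ?thesis by (simp add: K_def)
    qed
    have int: "integrable lborel (\<lambda>y. indicator (ball (x - k i) r) y * cnj (expo a y))" for i
    proof -
      have "integrable lborel (\<lambda>y. indicator (ball (x - k i) r) y *\<^sub>R cnj (expo a y))"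
        by (rule integrableI_bounded_set_indicator[where B=1]) (auto intro!: emeasure_bounded_finite[unfolded infinity_ennreal_def] borel_measurable_cnj)
      then show ?thesis
        by (rule Bochner_Integration.integrable_cong[THEN iffD1, rotated 2]) (auto simp: indicator_def)
    qed
    have "L2_inner unit_cube f (expo a) = (\<integral>y. f y * cnj (expo a y) \<partial>lebesgue)"
      unfolding L2_inner_def set_lebesgue_integral_def
    proof (rule Bochner_Integration.integral_cong[OF refl])
      fix y
      have "f y = 0" if "y \<notin> unit_cube"
        unfolding f_def using r(2) box_cube that by (intro sum.neutral) (auto simp: indicator_def subset_iff)
      then show "indicator unit_cube y *\<^sub>R (f y * cnj (expo a y)) = f y * cnj (expo a y)"
        by (auto simp: indicator_def)
    qed
    also have "\<dots> = (\<integral>y. f y * cnj (expo a y) \<partial>lborel)"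
      by (intro integral_completion)
        (auto intro!: borel_measurable_times borel_measurable_cnj borel_measurable_expo fm)
    also have "\<dots> = (\<integral>y. (\<Sum>i\<in>I. c i * (indicator (ball (x - k i) r) y * cnj (expo a y))) \<partial>lborel)"
      by (simp add: f_def sum_distrib_right mult.assoc)
    also have "\<dots> = (\<Sum>i\<in>I. c i * (expo e (k i) * K))"
      using int by (simp add: Bochner_Integration.integral_sum ball_int)
    also have "\<dots> = (\<Sum>i\<in>I. c i * expo e (k i)) * K"
      by (simp add: sum_distrib_right mult.assoc)
    finally show ?thesis using c(2) a(3) by simp
  qed
  ultimately have AE: "AE y in lebesgue. y \<in> unit_cube \<longrightarrow> f y = 0"
    by (rule complete)
  obtain j where j: "j \<in> I" "c j \<noteq> 0" using c(1) by blast
  \<comment> \<open>By disjointness only one ball contributes, so \<open>f\<close> is a nonzero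
    constant on a nonempty open subset of the cube.\<close>
  have nz: "f y = c j" if y: "y \<in> ball (x - k j) r" for y
  proof -
    have "f y = (\<Sum>i\<in>I. if i = j then c j else 0)"
      unfolding f_def
    proof (rule sum.cong[OF refl])
      fix i assume i: "i \<in> I"
      show "c i * indicator (ball (x - k i) r) y = (if i = j then c j else 0)"
      proof (cases "i = j")
        case True
        with y show ?thesis by simp
      next
        case False
        have "y \<notin> ball (x - k i) r"
        proof
          assume "y \<in> ball (x - k i) r"
          then have "dist (x - k i) (x - k j) < r + r"
            using y dist_triangle[of "x - k i" "x - k j" y] by (simp add: dist_commute)
          then show False using r(3) i j(1) False by force
        qed
        with False show ?thesis by simp
      qed
    qed
    then show ?thesis using finI j(1) by simp
  qed
  obtain N where N: "\<And>y. y \<in> space lebesgue - N \<Longrightarrow> y \<in> unit_cube \<longrightarrow> f y = 0" "N \<in> null_sets lebesgue"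
    using AE by (rule AE_E3) (rule that)
  have "ball (x - k j) r \<subseteq> N"
  proof
    fix y assume y: "y \<in> ball (x - k j) r"
    then have "y \<in> unit_cube" using r(2) j(1) box_cube by blast
    with nz[OF y] j(2) show "y \<in> N" using N(1)[of y] by auto
  qed
  then have "ball (x - k j) r = {}"
    using open_subset_null_set_empty[OF open_ball _ N(2)] by blast
  with r(1) show False by simp
qed

end

section \<open>Combining the implications\<close>

theorem theorem4p2:
  fixes R :: "real^'n^'n" and E :: "(real^'n) set"
  assumes "invertible R"
    and "finite E"
    and "lattice R \<inter> diffset E E = {0}"
  shows "(spectral_pair unit_cube (sumset (lattice R) E) \<longleftrightarrow> is_tile unit_cube (sumset (lattice R) E))
       \<and> (is_tile unit_cube (sumset (lattice R) E) \<longleftrightarrow>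
            (real (card E) = \<bar>det R\<bar> \<and> sumset (lattice R) (diffset E E) \<subseteq> Z_cube \<union> {0}))"
proof -
  let ?L = "sumset (lattice R) E"
  obtain l :: "nat \<Rightarrow> real^'n" where l: "bij_betw l UNIV (lattice R)"
    using lattice_enumeration[OF assms(1)] .
  note ctx = assms l
  let ?Z = "\<forall>a\<in>?L. \<forall>b\<in>?L. a \<noteq> b \<longrightarrow> a - b \<in> Z_cube"
  \<comment> \<open>Tiling and spectrality are each matched with the cardinality condition together
    with the pairwise form \<open>?Z\<close> of the difference condition.\<close>
  have tile: "is_tile unit_cube ?L \<longleftrightarrow> real (card E) = \<bar>det R\<bar> \<and> ?Z"
    using tile_imp_card[OF ctx] tile_imp_Z_cube[OF ctx] Z_cube_imp_tile[OF ctx] by metis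
  have cube: "unit_cube \<in> sets (lebesgue :: (real^'n) measure)"
    "emeasure lebesgue (unit_cube :: (real^'n) set) = 1"
    using unit_cube_lebesgue unit_cube_borel by (auto simp: emeasure_unit_cube)
  have "spectral_pair unit_cube ?L \<longleftrightarrow> real (card E) = \<bar>det R\<bar> \<and> ?Z"
  proof
    assume sp: "spectral_pair unit_cube ?L"
    then have Z: ?Z
      unfolding spectral_pair_def L2_inner_expo cube_FT_eq_0_iff by blast
    \<comment> \<open>Orthogonality alone makes the cubes a packing and bounds \<open>card E\<close>
      above; completeness supplies the reverse bound.\<close>
    moreover have "real (card E) \<le> \<bar>det R\<bar>"
      by (rule Z_cube_imp_card_le[OF ctx]) (use Z in blast)
    moreover have "\<bar>det R\<bar> \<le> real (card E)"
      by (rule complete_imp_card_ge[OF ctx]) (use sp in \<open>auto simp: spectral_pair_def\<close>)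
    ultimately show "real (card E) = \<bar>det R\<bar> \<and> ?Z" by linarith
  next
    assume *: "real (card E) = \<bar>det R\<bar> \<and> ?Z"
    then show "spectral_pair unit_cube ?L"
      unfolding spectral_pair_def L2_inner_expo cube_FT_eq_0_iff
      using cube Z_cube_imp_complete[OF ctx] by auto
  qed
  with tile show ?thesis
    unfolding diff_in_Z_cube_iff by blast
qed

end
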